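(* Let $h>0$, let $B\subset\mathbb Z^8_h$ be bounded and let $f:\partial B\to\mathbb O$. Then: (1) there exists $u:\overline B\to\mathbb O$ with $D^hu(y)=0$ for every $y\in B$ and $u(y)=P^h_{\partial B}f(y)$ for every $y\in\partial B$; (2) there exists $v:\overline{\mathbb Z^8_h\setminus B}\to\mathbb O$ with $D^hv(y)=0$ for every $y\in\mathbb Z^8_h\setminus B$, $v(y)=Q^h_{\partial B}f(y)$ for every $y\in\partial B$, and $|v(y)|\to0$ as $|y|\to\infty$.
   Context: $\mathbb O$ is the real octonion algebra with basis $\mathbf e_0=1,\mathbf e_1,\dots,\mathbf e_7$, where $\mathbf e_i\mathbf e_j=-\delta_{ij}+\sum_k\varepsilon_{ijk}\mathbf e_k$ for $1\le i,j\le 7$, $\varepsilon_{ijk}$ totally antisymmetric with $\varepsilon_{ijk}=1$ for $ijk\in\{123,145,176,246,257,347,365\}$; $\overline{\mathbf e}_0=\mathbf e_0$, $\overline{\mathbf e}_l=-\mathbf e_l$ ($l\ge1$); $|\cdot|$ is the Euclidean norm. For $h>0$, $\mathbb Z^8_h=(h\mathbb Z)^8$, $e_0,\dots,e_7$ are the standard unit vectors of $\mathbb R^8$, $\chi_A$ is the indicator of $A$. $\partial_l^{+,h}f(x)=(f(x+he_l)-f(x))/h$, $\partial_l^{-,h}f(x)=(f(x)-f(x-he_l))/h$, $\partial_l^h=\frac12(\partial_l^{+,h}+\partial_l^{-,h})$, $D^hf=\sum_l\mathbf e_l\partial_l^hf$. $N(x)=\{x,x\pm he_0,\dots,x\pm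 he_7\}$; for $A\subset\mathbb Z^8_h$: $\partial A=\{x:\ N(x)\cap A\neq\emptyset,\ N(x)\cap(\mathbb Z^8_h\setminus A)\neq\emptyset\}$, $\overline A=A\cup\partial A$ (note $\partial(\mathbb Z^8_h\setminus B)=\partial B$). For $x\in\partial B$: $\Sigma(x)=\sum_l[(\partial_l^{+,h}\chi_B(x))^2+(\partial_l^{-,h}\chi_B(x))^2]$, $s(x)=\frac{h^8}{2}\sqrt{\Sigma(x)}$, $n_l^\pm(x)=-2\partial_l^{\pm,h}\chi_B(x)/\sqrt{\Sigma(x)}$, $\int_{\partial B}g\,dS=\sum_{x\in\partial B}g(x)s(x)$. Fundamental solution: $E^1(x)=\frac{1}{(2\pi)^8}\int_{[-\pi,\pi]^8}\frac{\sum_l\overline{\mathbf e}_l\sin u_l}{\sum_l\sin^2u_l}\sin(\sum_lu_lx_l)\,du$ ($x\in\mathbb Z^8$), $E^h(x)=h^{-7}E^1(x/h)$. Star product: $K^h(x,y)*g(x)=-\frac12\sum_{l=0}^7\big(E^h(he_l-x+y)n_l^-(x)+E^h(-he_l-x+y)n_l^+(x)\big)(\mathbf e_lg(x))$. For $g:\partial B\to\mathbb O$: $S^h_{\partial B}g(y)=2\int_{\partial B}K^h(x,y)*\big(g(x)-g(y)\big)dS(x)+g(y)$ ($y\in\partial B$), and the discrete Plemelj projections are $P^h_{\partial B}g=\frac12(g+S^h_{\partial B}g)$, $Q^h_{\partial B}g=\frac12(g-S^h_{\partial B}g)$. *)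

theory Defs
  imports "HOL-Analysis.Analysis"
begin

text \<open>Octonions are modelled as vectors in real^8 (component l = coefficient of e_l,
  for l = 0..7, index (of_nat l :: 8)); points of R^8 are also real^8.
  The Euclidean norm of real^8 is the norm |.| of the paper.\<close>

type_synonym oct = "real^8"

definition cmp :: "real^8 \<Rightarrow> nat \<Rightarrow> real" where
  "cmp a l = a $ (of_nat l :: 8)"

definition ebas :: "nat \<Rightarrow> real^8" where
  "ebas l = (\<chi> i. if i = (of_nat l :: 8) then 1 else 0)"

definition oct_triples :: "(nat \<times> nat \<times> nat) set" where
  "oct_triples = {(1,2,3),(1,4,5),(1,7,6),(2,4,6),(2,5,7),(3,4,7),(3,6,5)}"

definition eps :: "nat \<Rightarrow> nat \<Rightarrow> nat \<Rightarrow> real" where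
  "eps i j k =
     (if (i,j,k) \<in> oct_triples \<or> (j,k,i) \<in> oct_triples \<or> (k,i,j) \<in> oct_triples then 1
      else if (j,i,k) \<in> oct_triples \<or> (i,k,j) \<in> oct_triples \<or> (k,j,i) \<in> oct_triples then -1
      else 0)"

definition emul :: "nat \<Rightarrow> nat \<Rightarrow> real^8" where
  "emul i j =
     (if i = 0 then ebas j else if j = 0 then ebas i
      else (if i = j then - ebas 0 else 0) + (\<Sum>k\<in>{1..7}. eps i j k *\<^sub>R ebas k))"

definition omul :: "real^8 \<Rightarrow> real^8 \<Rightarrow> real^8" (infixl "\<star>" 70) where
  "a \<star> b = (\<Sum>i<8. \<Sum>j<8. (cmp a i * cmp b j) *\<^sub>R emul i j)"

definition ebas_conj :: "nat \<Rightarrow> real^8" where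
  "ebas_conj l = (if l = 0 then ebas 0 else - ebas l)"

definition lattice :: "real \<Rightarrow> (real^8) set" where
  "lattice h = {x. \<forall>i. \<exists>k::int. x $ i = h * of_int k}"

definition dplus :: "real \<Rightarrow> nat \<Rightarrow> (real^8 \<Rightarrow> 'a::real_vector) \<Rightarrow> real^8 \<Rightarrow> 'a" where
  "dplus h l f x = (1 / h) *\<^sub>R (f (x + h *\<^sub>R ebas l) - f x)"

definition dminus :: "real \<Rightarrow> nat \<Rightarrow> (real^8 \<Rightarrow> 'a::real_vector) \<Rightarrow> real^8 \<Rightarrow> 'a" where
  "dminus h l f x = (1 / h) *\<^sub>R (f x - f (x - h *\<^sub>R ebas l))"

definition dcent :: "real \<Rightarrow> nat \<Rightarrow> (real^8 \<Rightarrow> 'a::real_vector) \<Rightarrow> real^8 \<Rightarrow> 'a" where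
  "dcent h l f x = (1/2) *\<^sub>R (dplus h l f x + dminus h l f x)"

definition Dh :: "real \<Rightarrow> (real^8 \<Rightarrow> real^8) \<Rightarrow> real^8 \<Rightarrow> real^8" where
  "Dh h f x = (\<Sum>l<8. ebas l \<star> dcent h l f x)"

definition nbhd :: "real \<Rightarrow> real^8 \<Rightarrow> (real^8) set" where
  "nbhd h x = insert x ((\<lambda>l. x + h *\<^sub>R ebas l) ` {..<8} \<union> (\<lambda>l. x - h *\<^sub>R ebas l) ` {..<8})"

definition bd :: "real \<Rightarrow> (real^8) set \<Rightarrow> (real^8) set" where
  "bd h A = {x \<in> lattice h. nbhd h x \<inter> A \<noteq> {} \<and> nbhd h x \<inter> (lattice h - A) \<noteq> {}}"

definition chi :: "(real^8) set \<Rightarrow> real^8 \<Rightarrow> real" where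
  "chi A x = (if x \<in> A then 1 else 0)"

definition Sig :: "real \<Rightarrow> (real^8) set \<Rightarrow> real^8 \<Rightarrow> real" where
  "Sig h B x = (\<Sum>l<8. (dplus h l (chi B) x)\<^sup>2 + (dminus h l (chi B) x)\<^sup>2)"

definition sfun :: "real \<Rightarrow> (real^8) set \<Rightarrow> real^8 \<Rightarrow> real" where
  "sfun h B x = h ^ 8 / 2 * sqrt (Sig h B x)"

definition nplus :: "real \<Rightarrow> (real^8) set \<Rightarrow> nat \<Rightarrow> real^8 \<Rightarrow> real" where
  "nplus h B l x = - 2 * dplus h l (chi B) x / sqrt (Sig h B x)"

definition nminus :: "real \<Rightarrow> (real^8) set \<Rightarrow> nat \<Rightarrow> real^8 \<Rightarrow> real" where
  "nminus h B l x = - 2 * dminus h l (chi B) x / sqrt (Sig h B x)"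

definition bd_int :: "real \<Rightarrow> (real^8) set \<Rightarrow> (real^8 \<Rightarrow> real^8) \<Rightarrow> real^8" where
  "bd_int h B g = (\<Sum>x\<in>bd h B. sfun h B x *\<^sub>R g x)"

text \<open>Discrete fundamental solution E^1 on Z^8 and E^h.\<close>
definition E1 :: "real^8 \<Rightarrow> real^8" where
  "E1 x = (1 / (2 * pi) ^ 8) *\<^sub>R
     integral (cbox (\<chi> i. - pi) (\<chi> i. pi))
       (\<lambda>u. (sin (u \<bullet> x) / (\<Sum>l<8. (sin (cmp u l))\<^sup>2)) *\<^sub>R
             (\<Sum>l<8. sin (cmp u l) *\<^sub>R ebas_conj l))"

definition Eh :: "real \<Rightarrow> real^8 \<Rightarrow> real^8" where
  "Eh h x = (1 / h ^ 7) *\<^sub>R E1 ((1 / h) *\<^sub>R x)"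

text \<open>Star product K^h(x,y) * w, where w plays the role of g(x).\<close>
definition Kstar :: "real \<Rightarrow> (real^8) set \<Rightarrow> real^8 \<Rightarrow> real^8 \<Rightarrow> real^8 \<Rightarrow> real^8" where
  "Kstar h B x y w = - (1/2) *\<^sub>R (\<Sum>l<8.
      (nminus h B l x *\<^sub>R Eh h (h *\<^sub>R ebas l - x + y) + nplus h B l x *\<^sub>R Eh h (- (h *\<^sub>R ebas l) - x + y))
      \<star> (ebas l \<star> w))"

definition Sh :: "real \<Rightarrow> (real^8) set \<Rightarrow> (real^8 \<Rightarrow> real^8) \<Rightarrow> real^8 \<Rightarrow> real^8" where
  "Sh h B g y = 2 *\<^sub>R bd_int h B (\<lambda>x. Kstar h B x y (g x - g y)) + g y"

definition Ph :: "real \<Rightarrow> (real^8) set \<Rightarrow> (real^8 \<Rightarrow> real^8) \<Rightarrow> real^8 \<Rightarrow> real^8" where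
  "Ph h B g y = (1/2) *\<^sub>R (g y + Sh h B g y)"

definition Qh :: "real \<Rightarrow> (real^8) set \<Rightarrow> (real^8 \<Rightarrow> real^8) \<Rightarrow> real^8 \<Rightarrow> real^8" where
  "Qh h B g y = (1/2) *\<^sub>R (g y - Sh h B g y)"

end

theory Submission
  imports Defs
begin

text \<open>Let \<open>F g (y) = \<integral> K(x,y) * g(x) dS(x)\<close>, a function on the whole lattice, and extend \<open>f\<close> by zero
  off \<open>\<partial>B\<close>. Although \<open>O\<close> is not associative, the alternative laws \<open>a (a' w) = a' (a w) = |a|\<^sup>2 w\<close>
  (with \<open>a'\<close> the conjugate of \<open>a\<close>), applied under the Fourier integral, show that for constant \<open>w\<close>
  both \<open>D (E w)\<close> and \<open>\<Sum>\<^sub>l (\<partial>\<^sub>l E) (e\<^sub>l w)\<close> equal \<open>\<delta> w\<close>. The first identity gives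
  \<open>D (F f) = D (\<chi> f) - \<chi> D f\<close>; the second, after a summation by parts, gives \<open>F c = \<chi> c\<close> for
  constants, whence \<open>P f = F f + (1 - \<chi>) f\<close> and \<open>Q f = \<chi> f - F f\<close> on \<open>\<partial>B\<close>. Using the same formulas
  off \<open>\<partial>B\<close> defines \<open>u\<close> and \<open>v\<close>. The decay of \<open>v\<close> is the Riemann--Lebesgue lemma for the
  integrable kernel of \<open>E\<close>.\<close>

section \<open>Octonion arithmetic\<close>

lemma eight_cases:
  fixes i :: nat
  assumes "i < 8"
  obtains "i = 0" | "i = 1" | "i = 2" | "i = 3" | "i = 4" | "i = 5" | "i = 6" | "i = 7"
  using assms by linarith

lemma sum_lessThan_8:
  fixes f :: "nat \<Rightarrow> 'a::comm_monoid_add"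
  shows "(\<Sum>i<8. f i) = f 0 + f 1 + f 2 + f 3 + f 4 + f 5 + f 6 + f 7"
  by (simp add: eval_nat_numeral)

lemma inj_on_of_nat_8: "inj_on (of_nat :: nat \<Rightarrow> 8) {..<8}"
proof (rule inj_onI)
  fix i j :: nat
  assume "i \<in> {..<8}" "j \<in> {..<8}" and eq: "(of_nat i :: 8) = of_nat j"
  then have "i < 8" "j < 8" by auto
  then show "i = j"
    using eq by (elim eight_cases) simp_all
qed

text \<open>Arithmetic in the index type \<open>8\<close> is modulo 8, so the naturals below 8
  address every component exactly once. This links vectors indexed by the type to the sums over
  \<open>{..<8}\<close> in the definitions.\<close>

lemma bij_betw_of_nat_8: "bij_betw (of_nat :: nat \<Rightarrow> 8) {..<8} UNIV"
proof -
  have "of_nat ` {..<8} = (UNIV :: 8 set)"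
    by (rule card_subset_eq) (simp_all add: card_image inj_on_of_nat_8)
  then show ?thesis
    using inj_on_of_nat_8 by (simp add: bij_betw_def)
qed

lemma of_nat_8_eq_iff:
  assumes "i < 8" "j < 8"
  shows "(of_nat i :: 8) = of_nat j \<longleftrightarrow> i = j"
  using assms inj_on_of_nat_8 by (auto simp: inj_on_def)

lemma cmp_add [simp]: "cmp (a + b) i = cmp a i + cmp b i"
  and cmp_diff [simp]: "cmp (a - b) i = cmp a i - cmp b i"
  and cmp_minus [simp]: "cmp (- a) i = - cmp a i"
  and cmp_scaleR [simp]: "cmp (c *\<^sub>R a) i = c * cmp a i"
  and cmp_zero [simp]: "cmp 0 i = 0"
  and cmp_sum [simp]: "cmp (\<Sum>x\<in>A. f x) i = (\<Sum>x\<in>A. cmp (f x) i)"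
  by (simp_all add: cmp_def)

lemma cmp_ebas: "i < 8 \<Longrightarrow> j < 8 \<Longrightarrow> cmp (ebas i) j = (if i = j then 1 else 0)"
  by (auto simp: cmp_def ebas_def of_nat_8_eq_iff)

lemma cmp_eqI:
  assumes "\<And>i. i < 8 \<Longrightarrow> cmp a i = cmp b i"
  shows "a = b"
proof -
  have "a $ k = b $ k" for k
    using bij_betw_imp_surj_on[OF bij_betw_of_nat_8] assms
    by (metis UNIV_I cmp_def image_iff lessThan_iff)
  then show ?thesis by (simp add: vec_eq_iff)
qed

lemma inner_eq_sum_cmp: "a \<bullet> b = (\<Sum>l<8. cmp a l * cmp b l)"
proof -
  have "a \<bullet> b = (\<Sum>k\<in>UNIV. a $ k * b $ k)"
    by (simp add: inner_vec_def)
  also have "\<dots> = (\<Sum>l<8. cmp a l * cmp b l)"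
    using sum.reindex_bij_betw[OF bij_betw_of_nat_8, of "\<lambda>k. a $ k * b $ k"]
    by (simp add: cmp_def)
  finally show ?thesis .
qed

lemma inner_ebas [simp]: "l < 8 \<Longrightarrow> ebas l \<bullet> x = cmp x l" "l < 8 \<Longrightarrow> x \<bullet> ebas l = cmp x l"
  by (simp_all add: inner_eq_sum_cmp cmp_ebas if_distrib if_distribR cong: if_cong)

lemma cmp_emul:
  assumes "i < 8" "j < 8" "k < 8"
  shows "cmp (emul i j) k =
    (if i = 0 then if j = k then 1 else 0 else if j = 0 then if i = k then 1 else 0
     else (if i = j \<and> k = 0 then - 1 else 0) + (if k = 0 then 0 else eps i j k))"
proof -
  have "(\<Sum>m\<in>{1..7}. eps i j m * cmp (ebas m) k) = (\<Sum>m\<in>{1..7}. if m = k then eps i j m else 0)"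
    by (rule sum.cong) (use assms in \<open>auto simp: cmp_ebas\<close>)
  also have "\<dots> = (if k = 0 then 0 else eps i j k)"
    using assms by auto
  finally show ?thesis
    using assms by (auto simp: emul_def cmp_ebas)
qed

text \<open>The multiplication table encoded in \<open>oct_triples\<close>, expanded once and for
  all, so that octonion identities become polynomial identities in real coordinates.\<close>

lemma cmp_omul:
  shows
    "cmp (a \<star> b) 0 = cmp a 0 * cmp b 0 - cmp a 1 * cmp b 1 - cmp a 2 * cmp b 2 - cmp a 3 * cmp b 3 - cmp a 4 * cmp b 4 - cmp a 5 * cmp b 5 - cmp a 6 * cmp b 6 - cmp a 7 * cmp b 7"
and "cmp (a \<star> b) 1 = cmp a 0 * cmp b 1 + cmp a 1 * cmp b 0 + cmp a 2 * cmp b 3 - cmp a 3 * cmp b 2 + cmp a 4 * cmp b 5 - cmp a 5 * cmp b 4 - cmp a 6 * cmp b 7 + cmp a 7 * cmp b 6"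
and "cmp (a \<star> b) 2 = cmp a 0 * cmp b 2 - cmp a 1 * cmp b 3 + cmp a 2 * cmp b 0 + cmp a 3 * cmp b 1 + cmp a 4 * cmp b 6 + cmp a 5 * cmp b 7 - cmp a 6 * cmp b 4 - cmp a 7 * cmp b 5"
and "cmp (a \<star> b) 3 = cmp a 0 * cmp b 3 + cmp a 1 * cmp b 2 - cmp a 2 * cmp b 1 + cmp a 3 * cmp b 0 + cmp a 4 * cmp b 7 - cmp a 5 * cmp b 6 + cmp a 6 * cmp b 5 - cmp a 7 * cmp b 4"
and "cmp (a \<star> b) 4 = cmp a 0 * cmp b 4 - cmp a 1 * cmp b 5 - cmp a 2 * cmp b 6 - cmp a 3 * cmp b 7 + cmp a 4 * cmp b 0 + cmp a 5 * cmp b 1 + cmp a 6 * cmp b 2 + cmp a 7 * cmp b 3"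
and "cmp (a \<star> b) 5 = cmp a 0 * cmp b 5 + cmp a 1 * cmp b 4 - cmp a 2 * cmp b 7 + cmp a 3 * cmp b 6 - cmp a 4 * cmp b 1 + cmp a 5 * cmp b 0 - cmp a 6 * cmp b 3 + cmp a 7 * cmp b 2"
and "cmp (a \<star> b) 6 = cmp a 0 * cmp b 6 + cmp a 1 * cmp b 7 + cmp a 2 * cmp b 4 - cmp a 3 * cmp b 5 - cmp a 4 * cmp b 2 + cmp a 5 * cmp b 3 + cmp a 6 * cmp b 0 - cmp a 7 * cmp b 1"
and "cmp (a \<star> b) 7 = cmp a 0 * cmp b 7 - cmp a 1 * cmp b 6 + cmp a 2 * cmp b 5 + cmp a 3 * cmp b 4 - cmp a 4 * cmp b 3 - cmp a 5 * cmp b 2 + cmp a 6 * cmp b 1 + cmp a 7 * cmp b 0"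
  by (simp_all add: omul_def sum_lessThan_8 cmp_emul eps_def oct_triples_def)

text \<open>Here \<open>b\<close> is the conjugate of \<open>a\<close>, written as
  \<open>2 Re a - a\<close>. In this form both products reduce to \<open>a (a w)\<close>, so
  associativity is replaced by the alternative law \<open>a (a w) = (a a) w\<close>. The proof
  compares the eight coordinates directly.\<close>

lemma conj_mul_cancel:
  fixes a w :: "real^8"
  defines "b \<equiv> (2 * cmp a 0) *\<^sub>R ebas 0 - a"
  shows "b \<star> (a \<star> w) = (a \<bullet> a) *\<^sub>R w" "a \<star> (b \<star> w) = (a \<bullet> a) *\<^sub>R w"
proof -
  have b: "cmp b 0 = cmp a 0" "cmp b 1 = - cmp a 1" "cmp b 2 = - cmp a 2" "cmp b 3 = - cmp a 3"
    "cmp b 4 = - cmp a 4" "cmp b 5 = - cmp a 5" "cmp b 6 = - cmp a 6" "cmp b 7 = - cmp a 7"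
    by (simp_all add: b_def cmp_ebas)
  show "b \<star> (a \<star> w) = (a \<bullet> a) *\<^sub>R w"
    by (rule cmp_eqI, erule eight_cases)
       (simp_all add: cmp_omul b inner_eq_sum_cmp sum_lessThan_8 algebra_simps del: One_nat_def)
  show "a \<star> (b \<star> w) = (a \<bullet> a) *\<^sub>R w"
    by (rule cmp_eqI, erule eight_cases)
       (simp_all add: cmp_omul b inner_eq_sum_cmp sum_lessThan_8 algebra_simps del: One_nat_def)
qed

text \<open>Bilinearity is enough in finite dimension. Boundedness is what later lets multiplication
  pass through limits and integrals.\<close>

lemma bounded_bilinear_omul: "bounded_bilinear (\<star>)"
proof -
  have "linear (\<lambda>y. a \<star> y)" for a
    by (rule linearI) (simp_all add: omul_def cmp_add cmp_scaleR distrib_left distrib_right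
        scaleR_add_left sum.distrib scaleR_sum_right algebra_simps)
  moreover have "linear (\<lambda>x. x \<star> b)" for b
    by (rule linearI) (simp_all add: omul_def cmp_add cmp_scaleR distrib_left distrib_right
        scaleR_add_left sum.distrib scaleR_sum_right algebra_simps)
  ultimately show ?thesis
    by (simp add: bilinear_conv_bounded_bilinear [symmetric] bilinear_def)
qed

interpretation omul: bounded_bilinear "(\<star>)"
  by (rule bounded_bilinear_omul)

lemma continuous_cmp [continuous_intros]: "continuous_on A (\<lambda>x. cmp x l)"
  by (auto simp: cmp_def intro!: continuous_intros)

lemma borel_measurable_cmp [measurable]: "(\<lambda>x. cmp x l) \<in> borel_measurable borel"
  by (intro borel_measurable_continuous_onI continuous_cmp)

section \<open>Integrability of the one-dimensional weight \<open>1 / sqrt |sin t|\<close>\<close>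

lemma nn_integral_inverse_sqrt_sin:
  "(\<integral>\<^sup>+t. ennreal (indicator {-pi..pi} t / sqrt \<bar>sin t\<bar>) \<partial>lborel) < \<infinity>"
proof -
  \<comment> \<open>\<^const>\<open>sqrt\<close> is odd, so \<open>G\<close> is continuous across the zeros of \<open>sin\<close>, and
    \<open>G' = 1 / sqrt |sin| - 3 |sin| sqrt |sin|\<close>.\<close>
  define G where "G t = 2 * (cos t * sqrt (sin t))" for t
  define k where "k t = 1 / sqrt \<bar>sin t\<bar> - 3 * (\<bar>sin t\<bar> * sqrt \<bar>sin t\<bar>)" for t
  have "(k has_integral (G pi - G (-pi))) {-pi..pi}"
  proof (rule fundamental_theorem_of_calculus_interior_strong [where S = "{0}"])
    show "continuous_on {- pi..pi} G"
      unfolding G_def by (intro continuous_intros)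
    fix t assume "t \<in> {-pi<..<pi} - {0}"
    then have s: "sin t \<noteq> 0"
      using sin_gt_zero [of t] sin_gt_zero [of "-t"] by (cases "t > 0") auto
    define r where "r = sqrt \<bar>sin t\<bar>"
    have r: "r > 0" "r * r = \<bar>sin t\<bar>"
      using s by (simp_all add: r_def)
    have c: "cos t * cos t = 1 - (r * r) * (r * r)"
      using sin_cos_squared_add3 [of t] r by (simp add: power2_eq_square abs_mult_self_eq algebra_simps)
    have "(sqrt has_real_derivative 1 / (2 * r)) (at (sin t))"
      using s by (intro DERIV_real_sqrt_generic) (auto simp: r_def field_simps real_sqrt_minus)
    then have "((\<lambda>t. sqrt (sin t)) has_real_derivative 1 / (2 * r) * cos t) (at t)"
      by (intro DERIV_chain2) (auto intro!: derivative_eq_intros)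
    then have "(G has_real_derivative 2 * (- sin t * sqrt (sin t) + 1 / (2 * r) * cos t * cos t)) (at t)"
      unfolding G_def by (intro DERIV_cmult DERIV_mult DERIV_cos)
    moreover have "2 * (- sin t * sqrt (sin t) + 1 / (2 * r) * cos t * cos t) = k t"
    proof -
      have "sin t * sqrt (sin t) = r * r * r"
        using r by (cases "sin t \<ge> 0") (auto simp: r_def real_sqrt_minus)
      moreover have "1 / (2 * r) * cos t * cos t = (1 - (r * r) * (r * r)) / (2 * r)"
        by (simp add: c [symmetric])
      ultimately have "2 * (- sin t * sqrt (sin t) + 1 / (2 * r) * cos t * cos t) =
          2 * (- (r * r * r) + (1 - (r * r) * (r * r)) / (2 * r))"
        by (simp only: mult_minus_left)
      also have "\<dots> = 1 / r - 3 * (r * r * r)"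
        using r(1) by (simp add: field_simps)
      also have "\<dots> = k t"
        unfolding k_def r_def [symmetric] r(2) [symmetric] using r(1) by simp
      finally show ?thesis .
    qed
    ultimately show "(G has_vector_derivative k t) (at t)"
      by (simp add: has_real_derivative_iff_has_vector_derivative)
  qed auto
  moreover have "(\<lambda>t. 3 * (\<bar>sin t\<bar> * sqrt \<bar>sin t\<bar>)) integrable_on {-pi..pi}"
    by (intro integrable_continuous_interval continuous_intros)
  ultimately have "(\<lambda>t. k t + 3 * (\<bar>sin t\<bar> * sqrt \<bar>sin t\<bar>)) integrable_on {-pi..pi}"
    by (intro integrable_add) auto
  \<comment> \<open>Adding the continuous term back to \<open>k\<close> leaves the weight itself. It
    is nonnegative, so gauge integrability upgrades to absolute, hence Lebesgue,
    integrability.\<close>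
  then have "(\<lambda>t. 1 / sqrt \<bar>sin t\<bar>) absolutely_integrable_on {-pi..pi}"
    by (intro nonnegative_absolutely_integrable_1) (auto simp: k_def)
  then have "integrable lebesgue (\<lambda>t. indicator {-pi..pi} t / sqrt \<bar>sin t\<bar>)"
    by (simp add: set_integrable_def)
  then have "integrable lborel (\<lambda>t. indicator {-pi..pi} t / sqrt \<bar>sin t\<bar> :: real)"
    by (subst (asm) integrable_completion) auto
  then show ?thesis
    by (simp add: integrable_iff_bounded)
qed

section \<open>The Fourier kernel of the fundamental solution\<close>

definition cube :: "(real^8) set" where
  "cube = cbox (\<chi> i. - pi) (\<chi> i. pi)"

lemma Basis_8: "(Basis :: (real^8) set) = ebas ` {..<8}"
proof -
  have "(Basis :: (real^8) set) = range (\<lambda>i. axis i 1)"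
    by (auto simp: Basis_vec_def)
  also have "range (\<lambda>i :: 8. axis i (1::real)) = (\<lambda>l. axis (of_nat l) 1) ` {..<8}"
    unfolding bij_betw_imp_surj_on [OF bij_betw_of_nat_8, symmetric] image_image ..
  also have "\<dots> = ebas ` {..<8}"
    by (simp add: ebas_def axis_def cong: image_cong)
  finally show ?thesis .
qed

lemma inj_on_ebas: "inj_on ebas {..<8}"
proof (rule inj_onI)
  fix i j assume ij: "i \<in> {..<8::nat}" "j \<in> {..<8::nat}" and "ebas i = ebas j"
  then have "cmp (ebas i) i = cmp (ebas j) i" by simp
  then show "i = j"
    using ij by (simp add: cmp_ebas split: if_splits)
qed

lemma prod_Basis_8:
  "(\<Prod>b\<in>Basis. g (u \<bullet> b)) = (\<Prod>l<8. g (cmp u l))" for u :: "real^8"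
  by (simp add: Basis_8 prod.reindex [OF inj_on_ebas])

lemma mem_cube: "u \<in> cube \<longleftrightarrow> (\<forall>l<8. cmp u l \<in> {-pi..pi})"
proof -
  have "u \<in> cube \<longleftrightarrow> (\<forall>i. u $ i \<in> {-pi..pi})"
    by (simp add: cube_def mem_box_cart)
  also have "\<dots> \<longleftrightarrow> (\<forall>l<8. cmp u l \<in> {-pi..pi})"
    using bij_betw_imp_surj_on [OF bij_betw_of_nat_8]
    by (metis UNIV_I cmp_def image_iff lessThan_iff)
  finally show ?thesis .
qed

lemma indicator_cube: "(\<Prod>l<8. indicator {-pi..pi} (cmp u l)) = (indicator cube u :: 'a::field)"
proof (cases "u \<in> cube")
  case False
  then obtain l where "l < 8" "cmp u l \<notin> {-pi..pi}"
    by (auto simp: mem_cube)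
  then have "(\<Prod>l<8. indicator {-pi..pi} (cmp u l)) = (0 :: 'a)"
    by (intro prod_zero) (auto intro!: bexI [of _ l])
  with False show ?thesis by simp
qed (simp add: mem_cube)

text \<open>The symbol of the operator: for \<open>h = 1\<close>, applying \<open>Dh\<close> to the
  character \<open>exp (i u x)\<close> multiplies it by \<open>i\<close> times this octonion.
  \<open>sinvec_conj\<close> is its conjugate and \<open>sinsq\<close> its squared norm.\<close>

definition sinvec :: "real^8 \<Rightarrow> real^8" where
  "sinvec u = (\<Sum>l<8. sin (cmp u l) *\<^sub>R ebas l)"

definition sinvec_conj :: "real^8 \<Rightarrow> real^8" where
  "sinvec_conj u = (\<Sum>l<8. sin (cmp u l) *\<^sub>R ebas_conj l)"

definition sinsq :: "real^8 \<Rightarrow> real" where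
  "sinsq u = (\<Sum>l<8. (sin (cmp u l))\<^sup>2)"

lemma cmp_sinvec: "l < 8 \<Longrightarrow> cmp (sinvec u) l = sin (cmp u l)"
  by (simp add: sinvec_def cmp_ebas if_distrib cong: if_cong)

lemma cmp_ebas_conj: "i < 8 \<Longrightarrow> j < 8 \<Longrightarrow> cmp (ebas_conj i) j = (if i = j then if j = 0 then 1 else - 1 else 0)"
  by (simp add: ebas_conj_def cmp_ebas)

lemma cmp_sinvec_conj:
  "l < 8 \<Longrightarrow> cmp (sinvec_conj u) l = (if l = 0 then sin (cmp u l) else - sin (cmp u l))"
  by (simp add: sinvec_conj_def cmp_ebas_conj if_distrib cong: if_cong)

lemma sinvec_conj_eq: "sinvec_conj u = (2 * cmp (sinvec u) 0) *\<^sub>R ebas 0 - sinvec u"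
  by (rule cmp_eqI) (simp add: cmp_sinvec cmp_sinvec_conj cmp_ebas)

lemma inner_sinvec: "sinvec u \<bullet> sinvec u = sinsq u"
  by (simp add: inner_eq_sum_cmp cmp_sinvec sinsq_def power2_eq_square)

lemma norm_sinvec_conj: "norm (sinvec_conj u) = sqrt (sinsq u)"
proof -
  have "sinvec_conj u \<bullet> sinvec_conj u = sinsq u"
    unfolding inner_eq_sum_cmp sinsq_def
    by (rule sum.cong) (auto simp: cmp_sinvec_conj power2_eq_square)
  then show ?thesis by (simp add: norm_eq_sqrt_inner)
qed

lemma sinvec_mul_conj:
  "sinvec u \<star> (sinvec_conj u \<star> w) = sinsq u *\<^sub>R w"
  "sinvec_conj u \<star> (sinvec u \<star> w) = sinsq u *\<^sub>R w"
  using conj_mul_cancel [of "sinvec u" w] by (simp_all add: sinvec_conj_eq inner_sinvec)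

lemma sinsq_nonneg [simp]: "0 \<le> sinsq u"
  by (simp add: sinsq_def sum_nonneg)

text \<open>Two factors already suffice; the product over all coordinates is separable, which makes
  \<open>1 / |sin u|\<close> integrable by Tonelli.\<close>

lemma prod_sqrt_sin_le: "(\<Prod>l<8. sqrt \<bar>sin (cmp u l)\<bar>) \<le> sqrt (sinsq u)"
proof -
  define r where "r = sqrt (sqrt (sinsq u))"
  have le: "sqrt \<bar>sin (cmp u l)\<bar> \<le> r" if "l < 8" for l
  proof -
    have "(sin (cmp u l))\<^sup>2 \<le> sinsq u"
      unfolding sinsq_def using that by (intro member_le_sum) auto
    then show ?thesis
      unfolding r_def using real_sqrt_le_mono by fastforce
  qed
  \<comment> \<open>The first two factors are bounded by the fourth root \<open>r\<close> of
    \<open>sinsq u\<close>, the other six by 1.\<close>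
  have "(\<Prod>l<8. sqrt \<bar>sin (cmp u l)\<bar>) \<le> (\<Prod>l<8::nat. if l < 2 then r else 1)"
    by (rule prod_mono) (auto simp: le)
  also have "\<dots> = r * r"
    by (simp add: eval_nat_numeral)
  also have "\<dots> = sqrt (sinsq u)"
    by (simp add: r_def)
  finally show ?thesis .
qed

lemma cube_sets [measurable]: "cube \<in> sets borel"
  by (simp add: cube_def)

text \<open>Within the cube a coordinate sine vanishes only where that coordinate is
  \<open>-pi\<close>, \<open>0\<close> or \<open>pi\<close>, so the set is covered by finitely many
  hyperplanes. Points with a vanishing denominator can therefore be ignored under the
  integral.\<close>

lemma null_sin_zero: "{u \<in> cube. \<exists>l<8. sin (cmp u l) = 0} \<in> null_sets lborel"
proof -
  have "negligible (\<Union>l<8. \<Union>c\<in>{-pi, 0, pi}. {u. ebas l \<bullet> u = c})"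
  proof (intro negligible_Union finite_imageI ballI, goal_cases)
    case (2 S)
    then obtain l where l: "l < 8" "S = (\<Union>c\<in>{-pi, 0, pi}. {u. ebas l \<bullet> u = c})"
      by auto
    have "ebas l \<noteq> 0"
      using cmp_ebas [of l l] l by auto
    then show ?case
      unfolding l by (intro negligible_Union finite_imageI ballI) (auto intro: negligible_hyperplane)
  qed auto
  moreover have "{u \<in> cube. \<exists>l<8. sin (cmp u l) = 0} \<subseteq> (\<Union>l<8. \<Union>c\<in>{-pi, 0, pi}. {u. ebas l \<bullet> u = c})"
  proof clarify
    fix u l assume u: "u \<in> cube" and l: "l < (8::nat)" and s: "sin (cmp u l) = 0"
    have "cmp u l \<in> {-pi, 0, pi}"
      using u l s sin_gt_zero [of "cmp u l"] sin_gt_zero [of "- cmp u l"] by (force simp: mem_cube)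
    then show "u \<in> (\<Union>l<8. \<Union>c\<in>{-pi, 0, pi}. {u. ebas l \<bullet> u = c})"
      using l by auto
  qed
  ultimately have "negligible {u \<in> cube. \<exists>l<8. sin (cmp u l) = 0}"
    by (rule negligible_subset)
  moreover have "{u \<in> cube. \<exists>l<8. sin (cmp u l) = 0} \<in> sets lborel"
    by measurable
  ultimately show ?thesis
    by (simp add: negligible_iff_null_sets null_sets_completion_iff)
qed

lemma sinsq_pos: "l < 8 \<Longrightarrow> sin (cmp u l) \<noteq> 0 \<Longrightarrow> 0 < sinsq u"
  unfolding sinsq_def by (rule sum_pos2 [of _ l]) auto

lemma AE_sin_nonzero: "AE u in lborel. u \<in> cube \<longrightarrow> (\<forall>l<8. sin (cmp u l) \<noteq> 0)"
  using AE_not_in [OF null_sin_zero] by eventually_elim auto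

lemma borel_measurable_sinsq [measurable]: "sinsq \<in> borel_measurable borel"
  unfolding sinsq_def by measurable

lemma borel_measurable_sinvec_conj [measurable]: "sinvec_conj \<in> borel_measurable borel"
  unfolding sinvec_conj_def by measurable

text \<open>The inverse of the symbol \<open>sinvec\<close>, with the restriction to the cube built
  in so that all integrals run over the whole space. At zeros of \<open>sinsq\<close> the convention
  \<open>x / 0 = 0\<close> gives the value 0.\<close>

definition kern :: "real^8 \<Rightarrow> real^8" where
  "kern u = (indicator cube u / sinsq u) *\<^sub>R sinvec_conj u"

lemma borel_measurable_kern [measurable]: "kern \<in> borel_measurable borel"
  unfolding kern_def by measurable

text \<open>The norm of \<open>kern\<close> is \<open>1 / sqrt (sinsq u)\<close> on the cube, with
  singularities of order one at isolated points, which dimension eight tolerates. The majorant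
  \<open>w\<close> is a product of one-variable weights, so Tonelli reduces the claim to
  \<open>nn_integral_inverse_sqrt_sin\<close>.\<close>

lemma integrable_kern: "integrable lborel kern"
proof -
  define w where "w u = (\<Prod>l<8. indicator {-pi..pi} (cmp u l) / sqrt \<bar>sin (cmp u l)\<bar>)" for u :: "real^8"
  have [measurable]: "w \<in> borel_measurable borel"
    unfolding w_def by measurable
  have "(\<integral>\<^sup>+u. ennreal (w u) \<partial>lborel) =
    (\<integral>\<^sup>+u. (\<Prod>b\<in>Basis. ennreal (indicator {-pi..pi} (u \<bullet> b) / sqrt \<bar>sin (u \<bullet> b)\<bar>)) \<partial>(lborel :: (real^8) measure))"
    by (simp add: w_def prod_ennreal
        prod_Basis_8 [of "\<lambda>t. indicator {-pi..pi} t / sqrt \<bar>sin t\<bar>"])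
  also have "\<dots> = (\<Prod>b\<in>(Basis :: (real^8) set).
      \<integral>\<^sup>+t. ennreal (indicator {-pi..pi} t / sqrt \<bar>sin t\<bar>) \<partial>lborel)"
    by (rule nn_integral_lborel_prod) auto
  also have "\<dots> < \<infinity>"
    using nn_integral_inverse_sqrt_sin by (simp add: power_less_top_ennreal)
  finally have w: "integrable lborel w"
    by (intro integrableI_nonneg) (auto simp: w_def intro!: prod_nonneg)
  have "AE u in lborel. norm (kern u) \<le> norm (w u)"
    using AE_sin_nonzero
  proof eventually_elim
    case (elim u)
    show ?case
    proof (cases "u \<in> cube")
      case True
      then have pos: "0 < (\<Prod>l<8. sqrt \<bar>sin (cmp u l)\<bar>)"
        using elim by (intro prod_pos) auto
      have "norm (kern u) = 1 / sqrt (sinsq u)"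
        using True by (simp add: kern_def norm_sinvec_conj real_div_sqrt divide_simps)
      also have "\<dots> \<le> 1 / (\<Prod>l<8. sqrt \<bar>sin (cmp u l)\<bar>)"
        using prod_sqrt_sin_le [of u] pos by (intro divide_left_mono) (auto intro: mult_pos_pos less_le_trans)
      also have "\<dots> = w u"
        using indicator_cube [of u, where 'a = real] True by (simp add: w_def prod_dividef)
      finally show ?thesis by simp
    qed (simp add: kern_def)
  qed
  then show ?thesis
    by (intro Bochner_Integration.integrable_bound [OF w]) simp_all
qed

section \<open>Orthogonality of characters on the cube\<close>

lemma integral_lborel_prod:
  fixes f :: "'a::euclidean_space \<Rightarrow> real \<Rightarrow> complex"
  assumes int: "\<And>b. b \<in> Basis \<Longrightarrow> integrable lborel (f b)"
  shows "(\<integral>u. (\<Prod>b\<in>Basis. f b (u \<bullet> b)) \<partial>lborel) = (\<Prod>b\<in>Basis. \<integral>t. f b t \<partial>lborel)"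
proof -
  interpret product_sigma_finite "\<lambda>_::'a. lborel :: real measure" ..
  have [measurable]: "f b \<in> borel_measurable borel" if "b \<in> Basis" for b
    using int [OF that] by auto
  \<comment> \<open>Lebesgue measure is the image of the product measure indexed by
    \<open>Basis\<close>, under the map sending coordinates to the vector they describe.\<close>
  have "(\<integral>u. (\<Prod>b\<in>Basis. f b (u \<bullet> b)) \<partial>lborel) =
      (\<integral>g. (\<Prod>b\<in>Basis. f b ((\<Sum>c\<in>Basis. g c *\<^sub>R c) \<bullet> b)) \<partial>(\<Pi>\<^sub>M b\<in>(Basis :: 'a set). lborel))"
    by (subst lborel_eq, subst integral_distr) auto
  also have "\<dots> = (\<integral>g. (\<Prod>b\<in>Basis. f b (g b)) \<partial>(\<Pi>\<^sub>M b\<in>(Basis :: 'a set). lborel))"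
    by (intro Bochner_Integration.integral_cong prod.cong refl) simp
  also have "\<dots> = (\<Prod>b\<in>Basis. \<integral>t. f b t \<partial>lborel)"
    using int by (intro product_integral_prod) auto
  finally show ?thesis .
qed

text \<open>For a nonzero integer \<open>k\<close> the antiderivative \<open>F\<close> has period
  \<open>2 pi\<close>, so its values at the two endpoints cancel.\<close>

lemma exp_character_integral:
  fixes k :: real
  assumes "k \<in> \<int>"
  defines "f \<equiv> \<lambda>t. indicator {-pi..pi} t *\<^sub>R exp (\<i> * of_real (t * k))"
  shows "integrable lborel f" "(\<integral>t. f t \<partial>lborel) = (if k = 0 then 2 * pi else 0)"
proof -
  have si: "set_integrable lborel {-pi..pi} (\<lambda>t. exp (\<i> * of_real (t * k)))"
    unfolding set_integrable_def
    by (intro borel_integrable_compact continuous_intros) auto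
  then show "integrable lborel f"
    by (simp add: f_def set_integrable_def)
  have eq: "(\<integral>t. f t \<partial>lborel) = integral {-pi..pi} (\<lambda>t. exp (\<i> * of_real (t * k)))"
    using set_borel_integral_eq_integral(2) [OF si] by (simp add: f_def set_lebesgue_integral_def)
  show "(\<integral>t. f t \<partial>lborel) = (if k = 0 then 2 * pi else 0)"
  proof (cases "k = 0")
    case False
    define F where "F t = exp (\<i> * of_real (t * k)) / (\<i> * of_real k)" for t :: real
    have "((\<lambda>t. exp (\<i> * of_real (t * k))) has_integral (F pi - F (-pi))) {-pi..pi}"
    proof (rule fundamental_theorem_of_calculus)
      fix t :: real
      have ii: "- (\<i> * (z * \<i>)) = z" for z
        by (simp add: mult.commute [of z])
      have "((\<lambda>z. exp (\<i> * (z * of_real k)) / (\<i> * of_real k)) has_field_derivative exp (\<i> * (of_real t * of_real k)))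
              (at (of_real t))"
        using False by (auto intro!: derivative_eq_intros simp: ii)
      then have "(F has_vector_derivative exp (\<i> * of_real (t * k))) (at t)"
        using has_vector_derivative_real_field unfolding F_def by fastforce
      then show "(F has_vector_derivative exp (\<i> * of_real (t * k))) (at t within {-pi..pi})"
        by (rule has_vector_derivative_at_within)
    qed simp
    moreover have "F pi = F (-pi)"
    proof -
      obtain n where n: "k = of_int n"
        using assms(1) by (auto elim: Ints_cases)
      have "exp (\<i> * of_real (pi * k)) = exp (\<i> * of_real (-pi * k) + \<i> * (of_int n * (of_real pi * 2)))"
        by (simp add: n algebra_simps)
      also have "\<dots> = exp (\<i> * of_real (-pi * k))"
        by (rule exp_plus_2pin)
      finally show ?thesis
        unfolding F_def by simp
    qed
    ultimately show ?thesis
      using False by (simp add: eq integral_unique)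
  qed (simp add: eq scaleR_conv_of_real)
qed

text \<open>The cosine of a sum does not factor over the coordinates, but the complex exponential
  does. One nonzero coordinate of \<open>x\<close> makes the product of one-variable integrals
  vanish, and the real part is taken at the end.\<close>

lemma integral_cube_cos:
  fixes x :: "real^8"
  assumes "\<And>l. l < 8 \<Longrightarrow> cmp x l \<in> \<int>"
  shows "(\<integral>u. indicator cube u * cos (u \<bullet> x) \<partial>lborel) = (if x = 0 then (2 * pi) ^ 8 else 0)"
proof -
  define f where "f b t = indicator {-pi..pi} t *\<^sub>R exp (\<i> * of_real (t * (b \<bullet> x)))" for b :: "real^8" and t :: real
  have Z: "b \<bullet> x \<in> \<int>" if "b \<in> Basis" for b
    using that assms by (auto simp: Basis_8)
  have int: "integrable lborel (f b)" if "b \<in> Basis" for b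
    unfolding f_def using exp_character_integral(1) [OF Z [OF that]] .
  have prod: "(\<Prod>b\<in>Basis. f b (u \<bullet> b)) = indicator cube u * exp (\<i> * of_real (u \<bullet> x))" for u
  proof -
    have "(\<Prod>b\<in>Basis. f b (u \<bullet> b)) =
        (\<Prod>l<8. indicator {-pi..pi} (cmp u l) * exp (\<i> * of_real (cmp u l * cmp x l)))"
      by (simp add: Basis_8 prod.reindex [OF inj_on_ebas] f_def scaleR_conv_of_real of_real_indicator
          del: of_real_mult)
    also have "\<dots> = indicator cube u * exp (\<Sum>l<8. \<i> * of_real (cmp u l * cmp x l))"
      by (simp add: prod.distrib indicator_cube exp_sum del: of_real_mult)
    finally show ?thesis
      by (simp add: inner_eq_sum_cmp sum_distrib_left)
  qed
  have val: "(\<integral>t. f b t \<partial>lborel) = (if b \<bullet> x = 0 then 2 * pi else 0)" if "b \<in> Basis" for b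
    unfolding f_def using exp_character_integral(2) [OF Z [OF that]] .
  have "(\<integral>u. indicator cube u * exp (\<i> * of_real (u \<bullet> x)) \<partial>lborel) = (\<Prod>b\<in>Basis. \<integral>t. f b t \<partial>lborel)"
    unfolding prod [symmetric] by (intro integral_lborel_prod int)
  also have "\<dots> = (\<Prod>b\<in>(Basis :: (real^8) set). if b \<bullet> x = 0 then 2 * pi else 0)"
    using val by simp
  also have "\<dots> = of_real (if x = 0 then (2 * pi) ^ 8 else 0)"
  proof (cases "x = 0")
    case False
    then obtain b where "b \<in> Basis" "b \<bullet> x \<noteq> 0"
      by (metis euclidean_all_zero_iff inner_commute)
    then have "(\<Prod>b\<in>(Basis :: (real^8) set). if b \<bullet> x = 0 then 2 * pi else 0) = (0 :: real)"
      by (intro prod_zero) auto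
    with False show ?thesis
      by simp
  qed simp
  finally have eq: "(\<integral>u. indicator cube u * exp (\<i> * of_real (u \<bullet> x)) \<partial>lborel) =
    of_real (if x = 0 then (2 * pi) ^ 8 else 0)" .
  have "set_integrable lborel cube (\<lambda>u. exp (\<i> * of_real (u \<bullet> x)))"
    unfolding set_integrable_def cube_def
    by (intro borel_integrable_compact continuous_intros) auto
  then have "integrable lborel (\<lambda>u. indicator cube u * exp (\<i> * of_real (u \<bullet> x)))"
    by (simp add: set_integrable_def scaleR_conv_of_real of_real_indicator)
  then have "(\<integral>u. Re (indicator cube u * exp (\<i> * of_real (u \<bullet> x))) \<partial>lborel) =
      Re (of_real (if x = 0 then (2 * pi) ^ 8 else 0))"
    unfolding eq [symmetric] by (rule integral_Re)
  moreover have "Re (indicator cube u * exp (\<i> * of_real (u \<bullet> x))) = indicator cube u * cos (u \<bullet> x)" for u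
    by (simp add: Re_exp indicator_def)
  ultimately show ?thesis
    by simp
qed

lemma integrable_scaleR_kern:
  assumes [measurable]: "g \<in> borel_measurable borel" and "\<And>u. \<bar>g u\<bar> \<le> 1"
  shows "integrable lborel (\<lambda>u. g u *\<^sub>R kern u)"
  by (rule Bochner_Integration.integrable_bound [OF integrable_kern])
     (use assms(2) in \<open>auto intro!: mult_left_le_one_le\<close>)

text \<open>Integrability of \<open>kern\<close> turns the gauge integral of the definition into a
  Lebesgue integral, for which dominated convergence and translation are at hand.\<close>

lemma E1_eq: "E1 x = (1 / (2 * pi) ^ 8) *\<^sub>R (\<integral>u. sin (u \<bullet> x) *\<^sub>R kern u \<partial>lborel)"
proof -
  define F where "F u = (sin (u \<bullet> x) / sinsq u) *\<^sub>R sinvec_conj u" for u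
  have F: "indicator cube u *\<^sub>R F u = sin (u \<bullet> x) *\<^sub>R kern u" for u
    by (simp add: F_def kern_def)
  have "integrable lborel (\<lambda>u. sin (u \<bullet> x) *\<^sub>R kern u)"
    by (rule integrable_scaleR_kern) auto
  then have "set_integrable lborel cube F"
    by (simp add: set_integrable_def F)
  from set_borel_integral_eq_integral(2) [OF this]
  have "integral cube F = (\<integral>u. sin (u \<bullet> x) *\<^sub>R kern u \<partial>lborel)"
    by (simp add: set_lebesgue_integral_def F)
  then show ?thesis
    by (simp add: E1_def F_def [abs_def] cube_def sinsq_def sinvec_conj_def)
qed

section \<open>The Riemann-Lebesgue lemma and the decay of the fundamental solution\<close>

lemma integral_lborel_translate:
  fixes f :: "'a::euclidean_space \<Rightarrow> 'b::{banach, second_countable_topology}"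
  assumes [measurable]: "f \<in> borel_measurable borel"
  shows "(\<integral>u. f (t + u) \<partial>lborel) = (\<integral>u. f u \<partial>lborel)"
proof -
  have "(\<integral>u. f u \<partial>lborel) = (\<integral>u. f u \<partial>(distr lborel borel ((+) t)))"
    by (simp add: lborel_distr_plus)
  also have "\<dots> = (\<integral>u. f (t + u) \<partial>lborel)"
    by (rule integral_distr) auto
  finally show ?thesis ..
qed

lemma integrable_sin_scaleR:
  fixes g :: "'a::euclidean_space \<Rightarrow> 'b::{banach, second_countable_topology}"
  assumes g: "integrable lborel g"
  shows "integrable lborel (\<lambda>u. sin (u \<bullet> x) *\<^sub>R g u)"
  by (rule Bochner_Integration.integrable_bound [OF g])
     (use g in \<open>auto intro!: mult_left_le_one_le\<close>)

lemma norm_integral_sin_scaleR_le: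
  fixes g :: "'a::euclidean_space \<Rightarrow> 'b::{banach, second_countable_topology}"
  assumes g: "integrable lborel g"
  shows "norm (\<integral>u. sin (u \<bullet> x) *\<^sub>R g u \<partial>lborel) \<le> (\<integral>u. norm (g u) \<partial>lborel)"
proof -
  have "norm (\<integral>u. sin (u \<bullet> x) *\<^sub>R g u \<partial>lborel) \<le> (\<integral>u. norm (sin (u \<bullet> x) *\<^sub>R g u) \<partial>lborel)"
    by (rule integral_norm_bound)
  also have "\<dots> \<le> (\<integral>u. norm (g u) \<partial>lborel)"
    by (rule integral_mono [OF integrable_norm [OF integrable_sin_scaleR [OF g]] integrable_norm [OF g]])
       (auto intro!: mult_left_le_one_le)
  finally show ?thesis .
qed

text \<open>Translating by \<open>pi x / |x|^2\<close> flips the sign of \<open>sin (u \<bullet> x)\<close>, so the integral is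
  controlled by the \<open>L\<^sup>1\<close> distance between \<open>f\<close> and a small translate of it.\<close>

lemma riemann_lebesgue_bounded:
  fixes f :: "'a::euclidean_space \<Rightarrow> 'b::{banach, second_countable_topology}"
  assumes meas [measurable]: "f \<in> borel_measurable borel"
    and bound: "\<And>u. norm (f u) \<le> M" and supp: "\<And>u. norm u > r \<Longrightarrow> f u = 0"
    and cont: "AE u in lborel. isCont f u" and "e > 0"
  shows "\<exists>R. \<forall>x. norm x > R \<longrightarrow> norm (\<integral>u. sin (u \<bullet> x) *\<^sub>R f u \<partial>lborel) < e"
proof (rule ccontr)
  define I where "I x = (\<integral>u. sin (u \<bullet> x) *\<^sub>R f u \<partial>lborel)" for x
  assume "\<not> ?thesis"
  \<comment> \<open>The offset 4 exceeds \<open>pi\<close>, which keeps every translation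
    \<open>t n\<close> of length at most 1.\<close>
  then have "\<exists>x. norm x > real n + 4 \<and> e \<le> norm (I x)" for n
    by (auto simp: I_def not_less)
  then obtain X where X: "\<And>n. norm (X n) > real n + 4" and e: "\<And>n. e \<le> norm (I (X n))"
    by metis
  define t where "t n = (pi / (norm (X n))\<^sup>2) *\<^sub>R X n" for n
  have X0: "norm (X n) > 0" for n
    using X [of n] by linarith
  have norm_t: "norm (t n) = pi / norm (X n)" for n
    using X0 [of n] by (simp add: t_def power2_eq_square)
  have t_le: "norm (t n) \<le> 1" for n
    using X [of n] X0 [of n] pi_less_4 by (simp add: norm_t)
  have t_X: "t n \<bullet> X n = pi" for n
    using X0 [of n] by (simp add: t_def dot_square_norm)
  have "real n \<le> norm (X n)" for n
    using X [of n] by linarith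
  then have "filterlim (\<lambda>n. norm (X n)) at_top sequentially"
    by (intro filterlim_at_top_mono [OF filterlim_real_sequentially] always_eventually) auto
  then have "(\<lambda>n. norm (t n)) \<longlonglongrightarrow> 0"
    unfolding norm_t by (rule tendsto_divide_0 [OF tendsto_const filterlim_at_top_imp_at_infinity])
  then have t0: "t \<longlonglongrightarrow> 0"
    by (rule tendsto_norm_zero_cancel)
  have M: "0 \<le> M"
    using bound [of 0] norm_ge_zero order_trans by blast
  \<comment> \<open>Since \<open>t n\<close> has length at most 1, \<open>f\<close> and all its
    translates vanish outside the ball of radius \<open>r + 1\<close>; hence one dominating function
    serves every \<open>n\<close>.\<close>
  define w where "w u = 2 * M * indicator (cball 0 (r + 1)) u" for u :: 'a
  have w: "integrable lborel w"
    unfolding w_def by (intro integrable_mult_right integrable_real_indicator)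
      (use emeasure_bounded_finite [OF bounded_cball] in \<open>auto simp: infinity_ennreal_def\<close>)
  have w_bound: "norm (f u - f (t n + u)) \<le> w u" for u n
  proof (cases "u \<in> cball 0 (r + 1)")
    case True
    then show ?thesis
      using norm_triangle_ineq4 [of "f u" "f (t n + u)"] bound [of u] bound [of "t n + u"]
      by (simp add: w_def)
  next
    case False
    then have "norm u > r + 1" by simp
    moreover from this have "norm (t n + u) > r"
      using norm_triangle_ineq4 [of "t n + u" "t n"] t_le [of n] by simp
    ultimately show ?thesis
      using M by (simp add: supp w_def)
  qed
  have lim: "(\<lambda>n. \<integral>u. norm (f u - f (t n + u)) \<partial>lborel) \<longlonglongrightarrow> integral\<^sup>L (lborel :: 'a measure) (\<lambda>_. 0)"
  proof (rule integral_dominated_convergence [OF _ _ w])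
    show "AE u in lborel. (\<lambda>n. norm (f u - f (t n + u))) \<longlonglongrightarrow> 0"
      using cont
    proof eventually_elim
      case (elim u)
      have "(\<lambda>n. t n + u) \<longlonglongrightarrow> 0 + u"
        by (intro tendsto_intros t0)
      then have "(\<lambda>n. f (t n + u)) \<longlonglongrightarrow> f u"
        using elim isCont_tendsto_compose by fastforce
      then have "(\<lambda>n. f u - f (t n + u)) \<longlonglongrightarrow> f u - f u"
        by (intro tendsto_intros)
      then show ?case
        using tendsto_norm by fastforce
    qed
  qed (use w_bound in auto)
  \<comment> \<open>Averaging \<open>I (X n)\<close> with its translated form, whose sine has the
    opposite sign, bounds it by half an integral that tends to 0. This contradicts the choice of
    \<open>X\<close>.\<close>
  have "2 * e \<le> (\<integral>u. norm (f u - f (t n + u)) \<partial>lborel)" for n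
  proof -
    have int: "integrable lborel f"
    proof (rule Bochner_Integration.integrable_bound [OF w _ AE_I2])
      show "norm (f u) \<le> norm (w u)" for u
        using bound [of u] supp [of u] M by (cases "u \<in> cball 0 (r + 1)") (auto simp: w_def)
    qed simp
    then have int': "integrable lborel (\<lambda>u. f (t n + u))"
      using lborel_distr_plus [of "t n"] integrable_distr [of "(+) (t n)" lborel borel f] by simp
    have "I (X n) = (\<integral>u. sin ((t n + u) \<bullet> X n) *\<^sub>R f (t n + u) \<partial>lborel)"
      unfolding I_def by (rule integral_lborel_translate [symmetric]) measurable
    also have "\<dots> = (\<integral>u. - (sin (u \<bullet> X n) *\<^sub>R f (t n + u)) \<partial>lborel)"
      by (simp add: inner_add_left t_X)
    finally have "I (X n) = - (\<integral>u. sin (u \<bullet> X n) *\<^sub>R f (t n + u) \<partial>lborel)"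
      by simp
    then have "2 *\<^sub>R I (X n) = I (X n) - (\<integral>u. sin (u \<bullet> X n) *\<^sub>R f (t n + u) \<partial>lborel)"
      by (simp add: scaleR_2)
    also have "\<dots> = (\<integral>u. sin (u \<bullet> X n) *\<^sub>R f u - sin (u \<bullet> X n) *\<^sub>R f (t n + u) \<partial>lborel)"
      unfolding I_def by (intro Bochner_Integration.integral_diff [symmetric] integrable_sin_scaleR int int')
    finally have "norm (2 *\<^sub>R I (X n)) = norm (\<integral>u. sin (u \<bullet> X n) *\<^sub>R (f u - f (t n + u)) \<partial>lborel)"
      by (simp add: scaleR_diff_right)
    also have "\<dots> \<le> (\<integral>u. norm (f u - f (t n + u)) \<partial>lborel)"
      by (intro norm_integral_sin_scaleR_le Bochner_Integration.integrable_diff int int')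
    finally show ?thesis
      using e [of n] by simp
  qed
  then have "2 * e \<le> 0"
    using LIMSEQ_le_const [OF lim] by auto
  then show False
    using \<open>e > 0\<close> by simp
qed

text \<open>\<open>kern\<close> is unbounded, so \<open>riemann_lebesgue_bounded\<close> does not
  apply to it directly. Adding \<open>d > 0\<close> to the denominator gives a bounded
  \<open>f d\<close>, continuous off the boundary of the cube, and \<open>f d\<close> tends to
  \<open>kern\<close> in the integral norm as \<open>d\<close> tends to 0. Each of the two errors is
  kept below \<open>e / 2\<close>.\<close>

lemma E1_tendsto_zero:
  assumes "e > 0"
  shows "\<exists>R. \<forall>x. norm x > R \<longrightarrow> norm (E1 x) < e"
proof -
  define f where "f d u = (indicator cube u / (sinsq u + d)) *\<^sub>R sinvec_conj u" for d and u :: "real^8"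
  have [measurable]: "f d \<in> borel_measurable borel" for d
    unfolding f_def by measurable
  \<comment> \<open>Where \<open>sinsq u\<close> vanishes so does \<open>sinvec_conj u\<close>, and
    both sides are 0; elsewhere a larger denominator only decreases the norm.\<close>
  have le: "norm (f d u) \<le> norm (kern u)" if "d > 0" for d u
  proof (cases "sinsq u = 0")
    case True
    then show ?thesis
      using norm_sinvec_conj [of u] by (simp add: f_def)
  next
    case False
    then have "0 < sinsq u"
      using sinsq_nonneg [of u] by linarith
    then show ?thesis
      using that unfolding f_def kern_def norm_scaleR
      by (intro mult_right_mono) (auto simp: indicator_def intro!: divide_left_mono)
  qed
  have int: "integrable lborel (f d)" if "d > 0" for d
    by (rule Bochner_Integration.integrable_bound [OF integrable_kern]) (use le that in auto)
  have lim: "(\<lambda>n. \<integral>u. norm (kern u - f (1 / real (Suc n)) u) \<partial>lborel) \<longlonglongrightarrow> integral\<^sup>L (lborel :: (real^8) measure) (\<lambda>_. 0)"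
  proof (rule integral_dominated_convergence)
    show "integrable lborel (\<lambda>u. 2 * norm (kern u))"
      using integrable_kern by auto
    show "AE u in lborel. norm (norm (kern u - f (1 / real (Suc n)) u)) \<le> 2 * norm (kern u)" for n
    proof (rule AE_I2)
      fix u
      have "norm (f (1 / real (Suc n)) u) \<le> norm (kern u)"
        by (rule le) simp
      then show "norm (norm (kern u - f (1 / real (Suc n)) u)) \<le> 2 * norm (kern u)"
        using norm_triangle_ineq4 [of "kern u" "f (1 / real (Suc n)) u"] by simp
    qed
    show "AE u in lborel. (\<lambda>n. norm (kern u - f (1 / real (Suc n)) u)) \<longlonglongrightarrow> 0"
    proof (rule AE_I2)
      fix u :: "real^8"
      show "(\<lambda>n. norm (kern u - f (1 / real (Suc n)) u)) \<longlonglongrightarrow> 0"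
      proof (cases "sinsq u = 0")
        case True
        then show ?thesis
          using norm_sinvec_conj [of u] by (simp add: f_def kern_def)
      next
        case False
        have "(\<lambda>n. sinsq u + 1 / real (Suc n)) \<longlonglongrightarrow> sinsq u + 0"
          by (intro tendsto_intros LIMSEQ_Suc [OF lim_1_over_n])
        then have "(\<lambda>n. f (1 / real (Suc n)) u) \<longlonglongrightarrow> kern u"
          unfolding f_def kern_def using False by (intro tendsto_intros) auto
        then have "(\<lambda>n. kern u - f (1 / real (Suc n)) u) \<longlonglongrightarrow> kern u - kern u"
          by (intro tendsto_intros)
        then show ?thesis
          using tendsto_norm by fastforce
      qed
    qed
  qed measurable
  then have "eventually (\<lambda>n. (\<integral>u. norm (kern u - f (1 / real (Suc n)) u) \<partial>lborel) < e / 2) sequentially"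
    using assms by (intro order_tendstoD) auto
  then obtain n where n: "(\<integral>u. norm (kern u - f (1 / real (Suc n)) u) \<partial>lborel) < e / 2"
    by (auto simp: eventually_sequentially)
  define d where "d = 1 / real (Suc n)"
  have d: "d > 0" by (simp add: d_def)
  have "bounded cube"
    by (simp add: cube_def)
  then obtain r where r: "\<And>u. u \<in> cube \<Longrightarrow> norm u \<le> r"
    by (auto simp: bounded_iff)
  have "\<exists>R. \<forall>x. norm x > R \<longrightarrow> norm (\<integral>u. sin (u \<bullet> x) *\<^sub>R f d u \<partial>lborel) < e / 2"
  proof (rule riemann_lebesgue_bounded)
    show "norm (f d u) \<le> sqrt 8 / d" for u
    proof -
      have "sinsq u \<le> (\<Sum>l<8::nat. 1)"
        unfolding sinsq_def by (intro sum_mono) (simp add: abs_square_le_1)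
      then have "sqrt (sinsq u) \<le> sqrt 8"
        by simp
      moreover have "\<bar>indicator cube u / (sinsq u + d)\<bar> \<le> 1 / d"
        using d sinsq_nonneg [of u] by (auto simp: indicator_def intro!: divide_left_mono mult_pos_pos add_nonneg_pos)
      ultimately have "\<bar>indicator cube u / (sinsq u + d)\<bar> * sqrt (sinsq u) \<le> 1 / d * sqrt 8"
        using d by (intro mult_mono) auto
      then show ?thesis
        by (simp add: f_def norm_sinvec_conj)
    qed
    show "f d u = 0" if "norm u > r" for u
      using r [of u] that by (auto simp: f_def indicator_def)
    have "AE u in lborel. u \<notin> cube - box (\<chi> i. - pi) (\<chi> i. pi)"
    proof (rule AE_not_in)
      show "cube - box (\<chi> i. - pi) (\<chi> i. pi) \<in> null_sets lborel"
        unfolding cube_def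
        by (rule null_setsI) (auto simp: emeasure_Diff emeasure_lborel_cbox_eq emeasure_lborel_box_eq box_subset_cbox)
    qed
    then show "AE u in lborel. isCont (f d) u"
    proof eventually_elim
      case (elim u)
      define g where "g c u = (c / (sinsq u + d)) *\<^sub>R sinvec_conj u" for c :: real and u
      have ne: "sinsq u + d \<noteq> 0" for u
        using d sinsq_nonneg [of u] by linarith
      have g: "isCont (g c) u" for c u
      proof -
        have "continuous_on UNIV (g c)"
          unfolding g_def sinsq_def sinvec_conj_def
          by (intro continuous_intros ballI) (use ne in \<open>auto simp: sinsq_def\<close>)
        then show ?thesis by (simp add: continuous_on_eq_continuous_at)
      qed
      \<comment> \<open>Off the boundary of the cube, \<open>f d\<close> agrees near
        \<open>u\<close> with \<open>g 1\<close> (inside) or \<open>g 0\<close> (outside), and both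
        are continuous everywhere.\<close>
      have "\<exists>c S. open S \<and> u \<in> S \<and> (\<forall>v\<in>S. f d v = g c v)"
      proof (cases "u \<in> cube")
        case True
        then show ?thesis
          using elim box_subset_cbox unfolding cube_def
          by (intro exI [of _ 1] exI [of _ "box (\<chi> i. - pi) (\<chi> i. pi)"])
             (auto simp: f_def g_def cube_def indicator_def open_box)
      next
        case False
        then show ?thesis
          by (intro exI [of _ 0] exI [of _ "- cube"])
             (auto simp: f_def g_def cube_def indicator_def closed_cbox open_Compl)
      qed
      then obtain c S where S: "open S" "u \<in> S" "\<And>v. v \<in> S \<Longrightarrow> f d v = g c v"
        by blast
      have "eventually (\<lambda>v. f d v = g c v) (nhds u)"
        using S by (auto simp: eventually_nhds)
      then show ?case
        using g isCont_cong by blast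
    qed
  qed (use assms in auto)
  then obtain R where R: "\<And>x. norm x > R \<Longrightarrow> norm (\<integral>u. sin (u \<bullet> x) *\<^sub>R f d u \<partial>lborel) < e / 2"
    by blast
  have "norm (E1 x) < e" if "norm x > R" for x
  proof -
    have split: "(\<integral>u. sin (u \<bullet> x) *\<^sub>R kern u \<partial>lborel) =
        (\<integral>u. sin (u \<bullet> x) *\<^sub>R (kern u - f d u) \<partial>lborel) + (\<integral>u. sin (u \<bullet> x) *\<^sub>R f d u \<partial>lborel)"
      using d by (subst Bochner_Integration.integral_add [symmetric])
        (auto intro!: integrable_sin_scaleR int integrable_kern simp: scaleR_diff_right)
    have "norm (\<integral>u. sin (u \<bullet> x) *\<^sub>R (kern u - f d u) \<partial>lborel) \<le> (\<integral>u. norm (kern u - f d u) \<partial>lborel)"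
      using d by (intro norm_integral_sin_scaleR_le Bochner_Integration.integrable_diff int integrable_kern)
    then have "norm (\<integral>u. sin (u \<bullet> x) *\<^sub>R kern u \<partial>lborel) < e"
      unfolding split using R [OF that] n [folded d_def]
        norm_triangle_ineq [of "\<integral>u. sin (u \<bullet> x) *\<^sub>R (kern u - f d u) \<partial>lborel"
          "\<integral>u. sin (u \<bullet> x) *\<^sub>R f d u \<partial>lborel"]
      by linarith
    moreover have "norm (E1 x) \<le> norm (\<integral>u. sin (u \<bullet> x) *\<^sub>R kern u \<partial>lborel)"
    proof -
      have "(1::real) \<le> (2 * pi) ^ 8"
        using pi_gt3 by (intro one_le_power) simp
      then have "1 / (2 * pi) ^ 8 \<le> 1"
        by (simp only: divide_le_eq_1_pos)
      then show ?thesis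
        unfolding E1_eq norm_scaleR by (intro mult_left_le_one_le) auto
    qed
    ultimately show ?thesis by simp
  qed
  then show ?thesis by blast
qed

section \<open>The fundamental solution\<close>

lemma lattice_zero [simp]: "0 \<in> lattice h"
  by (auto simp: lattice_def intro!: exI [of _ 0])

lemma lattice_add: "x \<in> lattice h \<Longrightarrow> y \<in> lattice h \<Longrightarrow> x + y \<in> lattice h"
  unfolding lattice_def by (clarsimp, metis distrib_left of_int_add)

lemma lattice_diff: "x \<in> lattice h \<Longrightarrow> y \<in> lattice h \<Longrightarrow> x - y \<in> lattice h"
  unfolding lattice_def by (clarsimp, metis right_diff_distrib of_int_diff)

lemma lattice_ebas: "h *\<^sub>R ebas l \<in> lattice h"
  unfolding lattice_def by (auto simp: ebas_def intro: exI [of _ 0] exI [of _ 1])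

lemma cmp_lattice_Ints: "z \<in> lattice h \<Longrightarrow> h > 0 \<Longrightarrow> cmp ((1 / h) *\<^sub>R z) l \<in> \<int>"
proof -
  assume z: "z \<in> lattice h" "h > 0"
  then obtain k where "z $ (of_nat l :: 8) = h * of_int k"
    unfolding lattice_def by blast
  then have "cmp ((1 / h) *\<^sub>R z) l = of_int k"
    using z by (simp add: cmp_def)
  then show ?thesis by simp
qed

lemma finite_lattice_bounded:
  assumes "h > 0" "B \<subseteq> lattice h" "bounded B"
  shows "finite B"
proof -
  obtain r where r: "\<And>x. x \<in> B \<Longrightarrow> norm x \<le> r"
    using assms(3) by (auto simp: bounded_iff)
  define K where "K = (\<lambda>k. h * of_int k) ` {- \<lceil>r / h\<rceil> .. \<lceil>r / h\<rceil>}"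
  have "x $ i \<in> K" if x: "x \<in> B" for x i
  proof -
    obtain k :: int where k: "x $ i = h * of_int k"
      using x assms(2) unfolding lattice_def by blast
    have "\<bar>x $ i\<bar> \<le> r"
      using component_le_norm_cart [of x i] r [OF x] by linarith
    then have "\<bar>of_int k\<bar> \<le> r / h"
      using assms(1) by (simp add: k abs_mult pos_le_divide_eq mult.commute)
    then have "\<bar>k\<bar> \<le> \<lceil>r / h\<rceil>"
      by linarith
    then show ?thesis
      unfolding k K_def by (intro imageI) auto
  qed
  then have "vec_nth ` B \<subseteq> PiE UNIV (\<lambda>_. K)"
    by auto
  then have "finite (vec_nth ` B)"
    by (rule finite_subset) (auto simp: K_def intro: finite_PiE)
  then show "finite B"
    by (rule finite_imageD) (auto simp: inj_on_def vec_eq_iff)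
qed

lemma dcent_eq: "dcent h l f x = (1 / (2 * h)) *\<^sub>R (f (x + h *\<^sub>R ebas l) - f (x - h *\<^sub>R ebas l))"
  by (simp add: dcent_def dplus_def dminus_def scaleR_right_diff_distrib [symmetric] scaleR_add_right [symmetric])

lemma Eh_integral:
  "Eh h z = (1 / (h ^ 7 * (2 * pi) ^ 8)) *\<^sub>R (\<integral>u. sin (u \<bullet> ((1 / h) *\<^sub>R z)) *\<^sub>R kern u \<partial>lborel)"
  by (simp add: Eh_def E1_eq)

text \<open>The identity \<open>sin (a + b) - sin (a - b) = 2 cos a sin b\<close> turns a symmetric
  difference of \<open>Eh\<close> into multiplication of the kernel by \<open>sin (cmp u l)\<close>.
  Dividing by \<open>2 h\<close> raises the power of \<open>h\<close> from 7 to 8.\<close>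

lemma dcent_Eh:
  assumes "h > 0" "l < 8"
  shows "dcent h l (Eh h) z = (1 / (h ^ 8 * (2 * pi) ^ 8)) *\<^sub>R
    (\<integral>u. (sin (cmp u l) * cos (u \<bullet> ((1 / h) *\<^sub>R z))) *\<^sub>R kern u \<partial>lborel)"
proof -
  define c where "c = 1 / (h ^ 7 * (2 * pi) ^ 8)"
  have int: "integrable lborel (\<lambda>u. sin (u \<bullet> x) *\<^sub>R kern u)" for x
    by (intro integrable_sin_scaleR integrable_kern)
  have sc: "(1 / h) *\<^sub>R (z + h *\<^sub>R ebas l) = (1 / h) *\<^sub>R z + ebas l"
    "(1 / h) *\<^sub>R (z - h *\<^sub>R ebas l) = (1 / h) *\<^sub>R z - ebas l"
    using assms by (simp_all add: scaleR_add_right scaleR_right_diff_distrib)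
  have "Eh h (z + h *\<^sub>R ebas l) - Eh h (z - h *\<^sub>R ebas l) = c *\<^sub>R
      (\<integral>u. sin (u \<bullet> ((1 / h) *\<^sub>R z + ebas l)) *\<^sub>R kern u - sin (u \<bullet> ((1 / h) *\<^sub>R z - ebas l)) *\<^sub>R kern u \<partial>lborel)"
    unfolding Eh_integral sc c_def
    by (subst Bochner_Integration.integral_diff [OF int int]) (simp only: scaleR_right_diff_distrib)
  also have "\<dots> = c *\<^sub>R (\<integral>u. 2 *\<^sub>R ((sin (cmp u l) * cos (u \<bullet> ((1 / h) *\<^sub>R z))) *\<^sub>R kern u) \<partial>lborel)"
    using assms
    by (simp only: scaleR_left_diff_distrib [symmetric] inner_add_right inner_diff_right inner_ebas
        sin_add sin_diff scaleR_scaleR) (simp add: mult.commute)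
  also have "\<dots> = (2 * c) *\<^sub>R (\<integral>u. (sin (cmp u l) * cos (u \<bullet> ((1 / h) *\<^sub>R z))) *\<^sub>R kern u \<partial>lborel)"
    by (subst Bochner_Integration.integral_scaleR_right)
       (auto simp only: scaleR_scaleR mult.commute [of c 2] abs_mult
          intro!: integrable_scaleR_kern mult_le_one abs_ge_zero abs_sin_le_one abs_cos_le_one)
  finally have eq: "Eh h (z + h *\<^sub>R ebas l) - Eh h (z - h *\<^sub>R ebas l) =
    (2 * c) *\<^sub>R (\<integral>u. (sin (cmp u l) * cos (u \<bullet> ((1 / h) *\<^sub>R z))) *\<^sub>R kern u \<partial>lborel)" .
  have "1 / (2 * h) * (2 * c) = 1 / (h ^ 8 * (2 * pi) ^ 8)"
    using assms by (simp add: c_def eval_nat_numeral)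
  then show ?thesis
    unfolding dcent_eq eq scaleR_scaleR by simp
qed

text \<open>The octonionic left and right versions of \<open>D E = \<delta>\<close> are the instances
  \<open>T l v = e\<^sub>l (v w)\<close> and \<open>T l v = v (e\<^sub>l w)\<close>; alternativity provides the hypothesis on \<open>T\<close>.\<close>

lemma sum_dcent_Eh:
  assumes h: "h > 0" and z: "z \<in> lattice h" and T: "\<And>l. l < 8 \<Longrightarrow> bounded_linear (T l)"
    and sym: "\<And>u. (\<Sum>l<8. sin (cmp u l) *\<^sub>R T l (sinvec_conj u)) = sinsq u *\<^sub>R (w :: real^8)"
  shows "(\<Sum>l<8. T l (dcent h l (Eh h) z)) = (if z = 0 then (1 / h ^ 8) *\<^sub>R w else 0)"
proof -
  define x where "x = (1 / h) *\<^sub>R z"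
  define c where "c = 1 / (h ^ 8 * (2 * pi) ^ 8)"
  define J where "J l u = (sin (cmp u l) * cos (u \<bullet> x)) *\<^sub>R kern u" for l u
  have J: "integrable lborel (J l)" for l
    unfolding J_def by (rule integrable_scaleR_kern) (auto simp: abs_mult intro!: mult_le_one)
  have "(\<Sum>l<8. T l (dcent h l (Eh h) z)) = (\<Sum>l<8. c *\<^sub>R (\<integral>u. T l (J l u) \<partial>lborel))"
  proof (rule sum.cong)
    fix l assume "l \<in> {..<8::nat}"
    then have l: "l < 8" by simp
    interpret bounded_linear "T l" by (rule T [OF l])
    have "T l (dcent h l (Eh h) z) = c *\<^sub>R T l (\<integral>u. J l u \<partial>lborel)"
      unfolding dcent_Eh [OF h l] c_def J_def x_def by (rule scaleR)
    also have "T l (\<integral>u. J l u \<partial>lborel) = (\<integral>u. T l (J l u) \<partial>lborel)"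
      by (rule integral_bounded_linear [OF T [OF l] J, symmetric])
    finally show "T l (dcent h l (Eh h) z) = c *\<^sub>R (\<integral>u. T l (J l u) \<partial>lborel)" .
  qed simp
  also have "\<dots> = c *\<^sub>R (\<integral>u. (\<Sum>l<8. T l (J l u)) \<partial>lborel)"
    by (subst Bochner_Integration.integral_sum)
       (auto simp: scaleR_sum_right intro!: integrable_bounded_linear [OF T] J)
  also have "(\<integral>u. (\<Sum>l<8. T l (J l u)) \<partial>lborel) = (\<integral>u. (indicator cube u * cos (u \<bullet> x)) *\<^sub>R w \<partial>lborel)"
  proof (rule integral_cong_AE)
    show "(\<lambda>u. \<Sum>l<8. T l (J l u)) \<in> borel_measurable lborel"
      by (intro borel_measurable_sum borel_measurable_integrable integrable_bounded_linear [OF T] J) auto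
    \<comment> \<open>Off the null set where some sine vanishes, \<open>sinsq u\<close> is positive,
      so the factor supplied by \<open>sym\<close> cancels the denominator of \<open>kern\<close>.
      Only the cosine remains, and its integral over the cube is a delta on the lattice.\<close>
    show "AE u in lborel. (\<Sum>l<8. T l (J l u)) = (indicator cube u * cos (u \<bullet> x)) *\<^sub>R w"
      using AE_sin_nonzero
    proof eventually_elim
      case (elim u)
      have "T l (J l u) = (cos (u \<bullet> x) * indicator cube u / sinsq u) *\<^sub>R (sin (cmp u l) *\<^sub>R T l (sinvec_conj u))"
        if "l < 8" for l
      proof -
        interpret bounded_linear "T l" by (rule T [OF that])
        show ?thesis by (simp add: J_def kern_def scaleR mult.commute)
      qed
      then have "(\<Sum>l<8. T l (J l u)) =
          (\<Sum>l<8. (cos (u \<bullet> x) * indicator cube u / sinsq u) *\<^sub>R (sin (cmp u l) *\<^sub>R T l (sinvec_conj u)))"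
        by (intro sum.cong) auto
      also have "\<dots> = (cos (u \<bullet> x) * indicator cube u / sinsq u) *\<^sub>R (sinsq u *\<^sub>R w)"
        by (simp only: scaleR_sum_right [symmetric] sym)
      also have "\<dots> = (indicator cube u * cos (u \<bullet> x)) *\<^sub>R w"
        using elim sinsq_pos [of 0 u] by (cases "u \<in> cube") auto
      finally show ?case .
    qed
  qed measurable
  also have "\<dots> = (\<integral>u. indicator cube u * cos (u \<bullet> x) \<partial>lborel) *\<^sub>R w"
  proof (rule integral_scaleR_left)
    have "set_integrable lborel cube (\<lambda>u. cos (u \<bullet> x))"
      unfolding set_integrable_def cube_def
      by (intro borel_integrable_compact continuous_intros) auto
    then show "integrable lborel (\<lambda>u. indicator cube u * cos (u \<bullet> x))"
      by (simp add: set_integrable_def)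
  qed
  also have "\<dots> = (if x = 0 then (2 * pi) ^ 8 else 0) *\<^sub>R w"
    using cmp_lattice_Ints [OF z h] by (subst integral_cube_cos) (auto simp: x_def)
  finally have "(\<Sum>l<8. T l (dcent h l (Eh h) z)) = c *\<^sub>R ((if x = 0 then (2 * pi) ^ 8 else 0) *\<^sub>R w)" .
  moreover have "x = 0 \<longleftrightarrow> z = 0"
    using h by (simp add: x_def)
  ultimately show ?thesis
    by (simp add: c_def)
qed

lemma sum_dcent_Eh_left:
  assumes "h > 0" "z \<in> lattice h"
  shows "(\<Sum>l<8. ebas l \<star> (dcent h l (Eh h) z \<star> w)) = (if z = 0 then (1 / h ^ 8) *\<^sub>R w else 0)"
proof (rule sum_dcent_Eh [OF assms])
  show "bounded_linear (\<lambda>v. ebas l \<star> (v \<star> w))" for l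
    by (intro bounded_linear_compose [OF omul.bounded_linear_right omul.bounded_linear_left])
  have "(\<Sum>l<8. sin (cmp u l) *\<^sub>R (ebas l \<star> (sinvec_conj u \<star> w))) = sinvec u \<star> (sinvec_conj u \<star> w)" for u
    by (simp add: sinvec_def omul.sum_left omul.scaleR_left)
  then show "(\<Sum>l<8. sin (cmp u l) *\<^sub>R (ebas l \<star> (sinvec_conj u \<star> w))) = sinsq u *\<^sub>R w" for u
    by (simp add: sinvec_mul_conj)
qed

lemma sum_dcent_Eh_right:
  assumes "h > 0" "z \<in> lattice h"
  shows "(\<Sum>l<8. dcent h l (Eh h) z \<star> (ebas l \<star> w)) = (if z = 0 then (1 / h ^ 8) *\<^sub>R w else 0)"
proof (rule sum_dcent_Eh [OF assms])
  show "bounded_linear (\<lambda>v. v \<star> (ebas l \<star> w))" for l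
    by (rule omul.bounded_linear_left)
  have "(\<Sum>l<8. sin (cmp u l) *\<^sub>R (sinvec_conj u \<star> (ebas l \<star> w))) = sinvec_conj u \<star> (sinvec u \<star> w)" for u
    by (simp add: sinvec_def omul.sum_left omul.scaleR_left omul.sum_right omul.scaleR_right)
  then show "(\<Sum>l<8. sin (cmp u l) *\<^sub>R (sinvec_conj u \<star> (ebas l \<star> w))) = sinsq u *\<^sub>R w" for u
    by (simp add: sinvec_mul_conj)
qed

lemma Eh_tendsto_zero:
  assumes "h > 0"
  shows "(Eh h \<longlongrightarrow> 0) at_infinity"
  unfolding tendsto_iff eventually_at_infinity
proof (intro allI impI)
  fix e :: real assume "e > 0"
  then have "e * h ^ 7 > 0"
    using assms by simp
  then obtain R where R: "\<And>x. norm x > R \<Longrightarrow> norm (E1 x) < e * h ^ 7"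
    using E1_tendsto_zero by blast
  have "dist (Eh h x) 0 < e" if "norm x \<ge> h * (R + 1)" for x
  proof -
    have "norm ((1 / h) *\<^sub>R x) > R"
      using that assms by (simp add: field_simps)
    from R [OF this] show ?thesis
      using assms by (simp add: Eh_def pos_divide_less_eq)
  qed
  then show "\<exists>b. \<forall>x. b \<le> norm x \<longrightarrow> dist (Eh h x) 0 < e"
    by blast
qed

section \<open>The discrete Cauchy integral\<close>

lemma dcent_Eh_mul:
  "dcent h l (\<lambda>y. Eh h (z + y) \<star> w) y = dcent h l (Eh h) (z + y) \<star> w"
  by (simp add: dcent_eq omul.scaleR_left omul.diff_left algebra_simps)

lemma Dh_Eh_mul:
  assumes "h > 0" "z + y \<in> lattice h"
  shows "Dh h (\<lambda>y. Eh h (z + y) \<star> w) y = (if z + y = 0 then (1 / h ^ 8) *\<^sub>R w else 0)"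
  using sum_dcent_Eh_left [OF assms, of w] by (simp add: Dh_def dcent_Eh_mul)

lemma dcent_add: "dcent h l (\<lambda>y. f y + g y) y = dcent h l f y + dcent h l g y"
  by (simp add: dcent_eq algebra_simps)

lemma dcent_diff: "dcent h l (\<lambda>y. f y - g y) y = dcent h l f y - dcent h l g y"
  by (simp add: dcent_eq algebra_simps)

lemma dcent_scaleR: "dcent h l (\<lambda>y. c *\<^sub>R f y) y = c *\<^sub>R dcent h l f y"
  by (simp add: dcent_eq scaleR_right_diff_distrib mult.commute)

lemma Dh_add: "Dh h (\<lambda>y. f y + g y) y = Dh h f y + Dh h g y"
  by (simp add: Dh_def dcent_add omul.add_right sum.distrib)

lemma Dh_diff: "Dh h (\<lambda>y. f y - g y) y = Dh h f y - Dh h g y"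
  by (simp add: Dh_def dcent_diff omul.diff_right sum_subtractf)

lemma Dh_scaleR: "Dh h (\<lambda>y. c *\<^sub>R f y) y = c *\<^sub>R Dh h f y"
  by (simp add: Dh_def dcent_scaleR omul.scaleR_right scaleR_sum_right)

lemma Dh_zero: "Dh h (\<lambda>y. 0) y = 0"
  by (simp add: Dh_def dcent_eq omul.zero_right)

lemma Dh_sum: "Dh h (\<lambda>y. \<Sum>x\<in>A. f x y) y = (\<Sum>x\<in>A. Dh h (f x) y)"
  by (induction A rule: infinite_finite_induct) (simp_all add: Dh_zero Dh_add)

text \<open>The operator \<open>F\<close> of the overview. Unlike \<open>Sh\<close> it subtracts no
  value at \<open>y\<close>, and it is evaluated on and off the boundary alike.\<close>

definition cauchy :: "real \<Rightarrow> (real^8) set \<Rightarrow> (real^8 \<Rightarrow> real^8) \<Rightarrow> real^8 \<Rightarrow> real^8" where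
  "cauchy h B g y = bd_int h B (\<lambda>x. Kstar h B x y (g x))"

text \<open>The square root in the surface density cancels the one in the normal. If
  \<open>Sig h B x\<close> is 0, every difference of \<open>chi B\<close> at \<open>x\<close> is 0
  too, so both sides vanish.\<close>

lemma sfun_normal:
  assumes "l < 8"
  shows "sfun h B x * nminus h B l x = - (h ^ 8 * dminus h l (chi B) x)"
    and "sfun h B x * nplus h B l x = - (h ^ 8 * dplus h l (chi B) x)"
proof -
  have "(dplus h l (chi B) x)\<^sup>2 + (dminus h l (chi B) x)\<^sup>2 \<le> Sig h B x"
    unfolding Sig_def using assms
    by (intro member_le_sum [of l "{..<8}" "\<lambda>l. (dplus h l (chi B) x)\<^sup>2 + (dminus h l (chi B) x)\<^sup>2"]) auto
  then have "dplus h l (chi B) x = 0 \<and> dminus h l (chi B) x = 0" if "Sig h B x = 0"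
    using that by (simp add: sum_power2_le_zero_iff)
  then show "sfun h B x * nminus h B l x = - (h ^ 8 * dminus h l (chi B) x)"
    and "sfun h B x * nplus h B l x = - (h ^ 8 * dplus h l (chi B) x)"
    by (cases "Sig h B x = 0"; simp add: sfun_def nminus_def nplus_def)+
qed

text \<open>The minus signs of the normals and of \<open>Kstar\<close> cancel, and no square root is
  left: the boundary enters only through differences of \<open>chi B\<close>.\<close>

lemma cauchy_eq:
  "cauchy h B g y = (h ^ 8 / 2) *\<^sub>R (\<Sum>x\<in>bd h B. \<Sum>l<8.
     (dminus h l (chi B) x *\<^sub>R Eh h (h *\<^sub>R ebas l - x + y) +
      dplus h l (chi B) x *\<^sub>R Eh h (- (h *\<^sub>R ebas l) - x + y)) \<star> (ebas l \<star> g x))"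
proof -
  have "sfun h B x *\<^sub>R Kstar h B x y w = (h ^ 8 / 2) *\<^sub>R (\<Sum>l<8.
     (dminus h l (chi B) x *\<^sub>R Eh h (h *\<^sub>R ebas l - x + y) +
      dplus h l (chi B) x *\<^sub>R Eh h (- (h *\<^sub>R ebas l) - x + y)) \<star> (ebas l \<star> w))" for x w
  proof -
    have "sfun h B x *\<^sub>R ((nminus h B l x *\<^sub>R a + nplus h B l x *\<^sub>R b) \<star> v) =
        (- (h ^ 8)) *\<^sub>R ((dminus h l (chi B) x *\<^sub>R a + dplus h l (chi B) x *\<^sub>R b) \<star> v)" if "l < 8" for l a b v
      unfolding omul.scaleR_left [symmetric] scaleR_add_right scaleR_scaleR sfun_normal [OF that] by simp
    then have eq: "(\<Sum>l<8. sfun h B x *\<^sub>R ((nminus h B l x *\<^sub>R Eh h (h *\<^sub>R ebas l - x + y) +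
        nplus h B l x *\<^sub>R Eh h (- (h *\<^sub>R ebas l) - x + y)) \<star> (ebas l \<star> w))) =
      (\<Sum>l<8. (- (h ^ 8)) *\<^sub>R ((dminus h l (chi B) x *\<^sub>R Eh h (h *\<^sub>R ebas l - x + y) +
        dplus h l (chi B) x *\<^sub>R Eh h (- (h *\<^sub>R ebas l) - x + y)) \<star> (ebas l \<star> w)))"
      by (intro sum.cong) auto
    show ?thesis
      unfolding Kstar_def scaleR_left_commute [of "sfun h B x"] scaleR_sum_right [of "sfun h B x"] eq
      unfolding scaleR_sum_right [symmetric] scaleR_scaleR by simp
  qed
  then show ?thesis
    by (simp add: cauchy_def bd_int_def scaleR_sum_right)
qed

text \<open>The neighbourhood of such a point lies entirely in \<open>B\<close> or entirely outside
  it. Boundary sums weighted by these differences may thus be extended to larger sets of lattice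
  points.\<close>

lemma chi_differences_zero:
  assumes "x \<notin> bd h B" "x \<in> lattice h" "l < 8"
  shows "dplus h l (chi B) x = 0" "dminus h l (chi B) x = 0"
proof -
  have mem: "x \<in> nbhd h x" "x + h *\<^sub>R ebas l \<in> nbhd h x" "x - h *\<^sub>R ebas l \<in> nbhd h x"
    using assms(3) by (auto simp: nbhd_def)
  have lat: "x + h *\<^sub>R ebas l \<in> lattice h" "x - h *\<^sub>R ebas l \<in> lattice h"
    using assms(2) by (auto intro: lattice_add lattice_diff lattice_ebas)
  have "chi B a = chi B x" if "a \<in> {x + h *\<^sub>R ebas l, x - h *\<^sub>R ebas l}" for a
    using assms(1,2) mem lat that unfolding bd_def chi_def by auto
  then show "dplus h l (chi B) x = 0" "dminus h l (chi B) x = 0"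
    by (simp_all add: dplus_def dminus_def)
qed

lemma bd_subset_lattice: "bd h B \<subseteq> lattice h"
  by (auto simp: bd_def)

text \<open>For each direction the identity \<open>D (E w) = delta w\<close>, used with
  \<open>w = ebas l \<star> g x\<close>, leaves only the two points
  \<open>y + h *\<^sub>R ebas l\<close> and \<open>y - h *\<^sub>R ebas l\<close>. A discrete
  product rule then assembles the right-hand side.\<close>

lemma Dh_cauchy:
  fixes g :: "real^8 \<Rightarrow> real^8"
  assumes h: "h > 0" and y: "y \<in> lattice h" and fin: "finite (bd h B)"
    and supp: "\<And>x. x \<notin> bd h B \<Longrightarrow> g x = 0"
  shows "Dh h (cauchy h B g) y = Dh h (\<lambda>x. chi B x *\<^sub>R g x) y - chi B y *\<^sub>R Dh h g y"
proof -
  have "Dh h (\<lambda>y. (a *\<^sub>R Eh h (h *\<^sub>R ebas l - x + y) + b *\<^sub>R Eh h (- (h *\<^sub>R ebas l) - x + y)) \<star> v) y =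
     (1 / h ^ 8) *\<^sub>R ((if x = y + h *\<^sub>R ebas l then a *\<^sub>R v else 0) + (if x = y - h *\<^sub>R ebas l then b *\<^sub>R v else 0))"
    if "x \<in> bd h B" for a b l x v
  proof -
    have x: "x \<in> lattice h"
      using that bd_subset_lattice by blast
    have lat: "h *\<^sub>R ebas l - x + y \<in> lattice h" "- (h *\<^sub>R ebas l) - x + y \<in> lattice h"
      using lattice_add [OF lattice_diff [OF lattice_ebas x] y]
        lattice_add [OF lattice_diff [OF lattice_diff [OF lattice_zero lattice_ebas] x] y] by simp_all
    have iff: "h *\<^sub>R ebas l - x + y = 0 \<longleftrightarrow> x = y + h *\<^sub>R ebas l"
      "- (h *\<^sub>R ebas l) - x + y = 0 \<longleftrightarrow> x = y - h *\<^sub>R ebas l"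
      by (auto simp: algebra_simps)
    show ?thesis
      unfolding omul.add_left omul.scaleR_left Dh_add Dh_scaleR Dh_Eh_mul [OF h lat(1)] Dh_Eh_mul [OF h lat(2)] iff
      by (simp add: scaleR_add_right)
  qed
  note Dh_summand = this
  \<comment> \<open>If \<open>a\<close> lies off the boundary the sum has no contribution, and the
    right side is 0 by \<open>supp\<close>; the two cases merge into one formula.\<close>
  have delta: "(\<Sum>x\<in>bd h B. if x = a then c x *\<^sub>R (ebas l \<star> g x) else 0) = c a *\<^sub>R (ebas l \<star> g a)" for a c l
    using fin supp [of a] by (cases "a \<in> bd h B") (simp_all add: omul.zero_right)
  \<comment> \<open>Here \<open>p\<close>, \<open>q\<close>, \<open>r\<close> stand for
    \<open>chi B\<close> at the forward neighbour, at \<open>y\<close> and at the backward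
    neighbour; \<open>a\<close> and \<open>b\<close> stand for \<open>g\<close> at the forward and
    backward neighbours.\<close>
  have leibniz: "(1 / 2) *\<^sub>R (((1 / h) *\<^sub>R (p - q)) *\<^sub>R a + ((1 / h) *\<^sub>R (q - r)) *\<^sub>R b) =
      (1 / (2 * h)) *\<^sub>R (p *\<^sub>R a - r *\<^sub>R b) - q *\<^sub>R ((1 / (2 * h)) *\<^sub>R (a - b))" for p q r and a b :: "real^8"
    by (rule cmp_eqI) (simp add: diff_divide_distrib add_divide_distrib algebra_simps)
  from Dh_summand have "Dh h (cauchy h B g) y = (h ^ 8 / 2) *\<^sub>R (\<Sum>x\<in>bd h B. \<Sum>l<8. (1 / h ^ 8) *\<^sub>R
     ((if x = y + h *\<^sub>R ebas l then dminus h l (chi B) x *\<^sub>R (ebas l \<star> g x) else 0) +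
      (if x = y - h *\<^sub>R ebas l then dplus h l (chi B) x *\<^sub>R (ebas l \<star> g x) else 0)))"
    by (simp add: cauchy_eq [abs_def] Dh_scaleR Dh_sum)
  also have "\<dots> = (1 / 2) *\<^sub>R (\<Sum>l<8. \<Sum>x\<in>bd h B.
     (if x = y + h *\<^sub>R ebas l then dminus h l (chi B) x *\<^sub>R (ebas l \<star> g x) else 0) +
      (if x = y - h *\<^sub>R ebas l then dplus h l (chi B) x *\<^sub>R (ebas l \<star> g x) else 0))"
    using h by (subst sum.swap) (simp add: scaleR_sum_right [symmetric])
  also have "\<dots> = (1 / 2) *\<^sub>R (\<Sum>l<8. dminus h l (chi B) (y + h *\<^sub>R ebas l) *\<^sub>R (ebas l \<star> g (y + h *\<^sub>R ebas l)) +
      dplus h l (chi B) (y - h *\<^sub>R ebas l) *\<^sub>R (ebas l \<star> g (y - h *\<^sub>R ebas l)))"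
    by (simp only: sum.distrib delta)
  also have "\<dots> = (\<Sum>l<8. ebas l \<star> (dcent h l (\<lambda>x. chi B x *\<^sub>R g x) y - chi B y *\<^sub>R dcent h l g y))"
    unfolding scaleR_sum_right
  proof (rule sum.cong)
    fix l
    have "(1 / 2) *\<^sub>R (dminus h l (chi B) (y + h *\<^sub>R ebas l) *\<^sub>R g (y + h *\<^sub>R ebas l) +
        dplus h l (chi B) (y - h *\<^sub>R ebas l) *\<^sub>R g (y - h *\<^sub>R ebas l)) =
      dcent h l (\<lambda>x. chi B x *\<^sub>R g x) y - chi B y *\<^sub>R dcent h l g y"
      unfolding dcent_eq dplus_def dminus_def add_diff_cancel diff_add_cancel by (rule leibniz)
    from arg_cong [OF this, of "(\<star>) (ebas l)"]
    show "(1 / 2) *\<^sub>R (dminus h l (chi B) (y + h *\<^sub>R ebas l) *\<^sub>R (ebas l \<star> g (y + h *\<^sub>R ebas l)) +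
        dplus h l (chi B) (y - h *\<^sub>R ebas l) *\<^sub>R (ebas l \<star> g (y - h *\<^sub>R ebas l))) =
      ebas l \<star> (dcent h l (\<lambda>x. chi B x *\<^sub>R g x) y - chi B y *\<^sub>R dcent h l g y)"
      by (simp only: omul.add_right omul.scaleR_right)
  qed simp
  also have "\<dots> = Dh h (\<lambda>x. chi B x *\<^sub>R g x) y - chi B y *\<^sub>R Dh h g y"
    by (simp add: Dh_def omul.diff_right omul.scaleR_right sum_subtractf scaleR_sum_right)
  finally show ?thesis .
qed

text \<open>The device for summation by parts: a shifted indicator selects a translate of
  \<open>B\<close>, and reindexing moves the shift to the other factor.\<close>

lemma sum_chi_shift:
  fixes k :: "real^8 \<Rightarrow> 'a::real_vector"
  assumes "finite X" "(\<lambda>x. x + d) ` B \<subseteq> X"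
  shows "(\<Sum>x\<in>X. chi B (x - d) *\<^sub>R k x) = (\<Sum>x\<in>B. k (x + d))"
proof -
  have "(\<Sum>x\<in>X. chi B (x - d) *\<^sub>R k x) = (\<Sum>x\<in>(\<lambda>x. x + d) ` B. k x)"
  proof (rule sum.mono_neutral_cong_right [OF assms], rule ballI)
    fix x assume "x \<in> X - (\<lambda>x. x + d) ` B"
    then have "x - d \<notin> B"
      by (metis DiffD2 diff_add_cancel imageI)
    then show "chi B (x - d) *\<^sub>R k x = 0"
      by (simp add: chi_def)
  qed (auto simp: chi_def)
  then show ?thesis
    by (simp add: sum.reindex)
qed

text \<open>Summation by parts moves the differences from \<open>chi B\<close> to \<open>Eh\<close>,
  which produces the sum over \<open>B\<close> of the delta from \<open>sum_dcent_Eh_right\<close>.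
  The bracketing in \<open>Kstar\<close> is the one that identity requires.\<close>

lemma cauchy_const:
  assumes h: "h > 0" and B: "B \<subseteq> lattice h" and fin: "finite B" and y: "y \<in> lattice h"
  shows "cauchy h B (\<lambda>_. c) y = chi B y *\<^sub>R c" "finite (bd h B)"
proof -
  \<comment> \<open>\<open>B\<close> with all its lattice neighbours: it contains the boundary and
    every translate of \<open>B\<close> that arises, so all sums can be taken over one finite
    set.\<close>
  define X where "X = B \<union> (\<Union>l<8. (\<lambda>x. x + h *\<^sub>R ebas l) ` B \<union> (\<lambda>x. x - h *\<^sub>R ebas l) ` B)"
  have finX: "finite X"
    using fin by (simp add: X_def)
  have X: "X \<subseteq> lattice h"
    using B by (auto simp: X_def intro: lattice_add lattice_diff lattice_ebas)
  have bdX: "bd h B \<subseteq> X"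
  proof
    fix x assume "x \<in> bd h B"
    then obtain b where b: "b \<in> B" "b \<in> nbhd h x"
      by (auto simp: bd_def)
    then consider "b = x" | l where "l < 8" "b = x + h *\<^sub>R ebas l" | l where "l < 8" "b = x - h *\<^sub>R ebas l"
      by (auto simp: nbhd_def)
    then show "x \<in> X"
    proof cases
      case 1
      with b show ?thesis by (simp add: X_def)
    next
      case 2
      then have "x = b - h *\<^sub>R ebas l" by simp
      with b 2(1) show ?thesis unfolding X_def by blast
    next
      case 3
      then have "x = b + h *\<^sub>R ebas l" by simp
      with b 3(1) show ?thesis unfolding X_def by blast
    qed
  qed
  with finX show "finite (bd h B)"
    by (rule rev_finite_subset)
  define T where "T x l = dminus h l (chi B) x *\<^sub>R Eh h (h *\<^sub>R ebas l - x + y) +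
      dplus h l (chi B) x *\<^sub>R Eh h (- (h *\<^sub>R ebas l) - x + y)" for x l
  have T: "(\<Sum>x\<in>X. T x l) = (\<Sum>x\<in>B. 2 *\<^sub>R dcent h l (Eh h) (y - x))" if l: "l < 8" for l
  proof -
    define d where "d = h *\<^sub>R ebas l"
    have sub: "(\<lambda>x. x + 0) ` B \<subseteq> X" "(\<lambda>x. x + d) ` B \<subseteq> X" "(\<lambda>x. x + - d) ` B \<subseteq> X"
      using l by (auto simp: X_def d_def)
    have "T x l = (1 / h) *\<^sub>R (chi B (x - 0) *\<^sub>R Eh h (y - x + d) - chi B (x - d) *\<^sub>R Eh h (y - x + d)
        + chi B (x - (- d)) *\<^sub>R Eh h (y - x - d) - chi B (x - 0) *\<^sub>R Eh h (y - x - d))" for x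
    proof -
      have shift: "d - x + y = y - x + d" "- d - x + y = y - x - d"
        by simp_all
      show ?thesis
        unfolding T_def dplus_def dminus_def d_def [symmetric] shift
        by (simp add: scaleR_add_right scaleR_right_diff_distrib scaleR_left_diff_distrib diff_divide_distrib)
    qed
    then have "(\<Sum>x\<in>X. T x l) = (1 / h) *\<^sub>R ((\<Sum>x\<in>B. Eh h (y - (x + 0) + d)) - (\<Sum>x\<in>B. Eh h (y - (x + d) + d))
        + (\<Sum>x\<in>B. Eh h (y - (x + - d) - d)) - (\<Sum>x\<in>B. Eh h (y - (x + 0) - d)))"
      using sum_chi_shift [OF finX sub(1), of "\<lambda>x. Eh h (y - x + d)"]
        sum_chi_shift [OF finX sub(2), of "\<lambda>x. Eh h (y - x + d)"]
        sum_chi_shift [OF finX sub(3), of "\<lambda>x. Eh h (y - x - d)"]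
        sum_chi_shift [OF finX sub(1), of "\<lambda>x. Eh h (y - x - d)"]
      by (simp only: scaleR_sum_right [symmetric] sum.distrib sum_subtractf)
    \<comment> \<open>The second and third sums both equal the sum of \<open>Eh h (y - x)\<close>
      over \<open>B\<close> and cancel; the first and fourth form the symmetric difference.\<close>
    also have "\<dots> = (\<Sum>x\<in>B. 2 *\<^sub>R dcent h l (Eh h) (y - x))"
      by (simp add: dcent_eq d_def scaleR_sum_right [symmetric] sum_subtractf)
    finally show ?thesis .
  qed
  have "cauchy h B (\<lambda>_. c) y = (h ^ 8 / 2) *\<^sub>R (\<Sum>x\<in>bd h B. \<Sum>l<8. T x l \<star> (ebas l \<star> c))"
    by (simp add: cauchy_eq T_def)
  also have "(\<Sum>x\<in>bd h B. \<Sum>l<8. T x l \<star> (ebas l \<star> c)) = (\<Sum>x\<in>X. \<Sum>l<8. T x l \<star> (ebas l \<star> c))"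
  proof (rule sum.mono_neutral_left [OF finX bdX], rule ballI, rule sum.neutral, rule ballI)
    fix x l assume "x \<in> X - bd h B" "l \<in> {..<8::nat}"
    then show "T x l \<star> (ebas l \<star> c) = 0"
      using X chi_differences_zero [of x h B l] by (auto simp: T_def omul.zero_left)
  qed
  also have "\<dots> = (\<Sum>l<8. (\<Sum>x\<in>X. T x l) \<star> (ebas l \<star> c))"
    by (subst sum.swap) (simp add: omul.sum_left)
  also have "\<dots> = 2 *\<^sub>R (\<Sum>l<8. \<Sum>x\<in>B. dcent h l (Eh h) (y - x) \<star> (ebas l \<star> c))"
    by (simp add: T omul.sum_left omul.scaleR_left scaleR_sum_right)
  also have "(\<Sum>l<8. \<Sum>x\<in>B. dcent h l (Eh h) (y - x) \<star> (ebas l \<star> c)) =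
      (\<Sum>x\<in>B. \<Sum>l<8. dcent h l (Eh h) (y - x) \<star> (ebas l \<star> c))"
    by (rule sum.swap)
  also have "\<dots> = (\<Sum>x\<in>B. if y = x then (1 / h ^ 8) *\<^sub>R c else 0)"
    using B lattice_diff [OF y] by (intro sum.cong refl) (subst sum_dcent_Eh_right [OF h], auto)
  also have "\<dots> = chi B y *\<^sub>R ((1 / h ^ 8) *\<^sub>R c)"
    using fin by (simp add: chi_def)
  finally show "cauchy h B (\<lambda>_. c) y = chi B y *\<^sub>R c"
    using h by simp
qed

lemma cauchy_tendsto_zero:
  assumes "h > 0"
  shows "(cauchy h B g \<longlongrightarrow> 0) at_infinity"
proof -
  have "((\<lambda>y. Eh h (c + y)) \<longlongrightarrow> 0) at_infinity" for c
    by (rule filterlim_compose [OF Eh_tendsto_zero [OF assms]])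
       (rule tendsto_add_filterlim_at_infinity [OF tendsto_const filterlim_ident])
  then have "(cauchy h B g \<longlongrightarrow> (h ^ 8 / 2) *\<^sub>R (\<Sum>x\<in>bd h B. \<Sum>l<8.
     (dminus h l (chi B) x *\<^sub>R 0 + dplus h l (chi B) x *\<^sub>R 0) \<star> (ebas l \<star> g x))) at_infinity"
    unfolding cauchy_eq [abs_def] by (intro tendsto_intros omul.tendsto)
  then show ?thesis
    by (simp add: omul.zero_left)
qed

text \<open>By linearity the value frozen at \<open>y\<close> in \<open>Sh\<close> splits off as the
  Cauchy integral of a constant, which \<open>cauchy_const\<close> evaluates.\<close>

lemma bd_int_Kstar_diff:
  "bd_int h B (\<lambda>x. Kstar h B x y (g x - c)) = cauchy h B g y - cauchy h B (\<lambda>_. c) y"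
proof -
  have "bd_int h B (\<lambda>x. Kstar h B x y (g x - c)) = cauchy h B (\<lambda>x. g x - c) y"
    by (simp add: cauchy_def)
  then show ?thesis
    by (simp add: cauchy_eq omul.diff_right sum_subtractf scaleR_right_diff_distrib)
qed

section \<open>The extensions of the two Plemelj projections\<close>

theorem mainTheorem11:
  fixes h :: real and B :: "(real^8) set" and f :: "real^8 \<Rightarrow> real^8"
  assumes "h > 0" and "B \<subseteq> lattice h" and "bounded B"
  shows "(\<exists>u :: real^8 \<Rightarrow> real^8.
            (\<forall>y\<in>B. Dh h u y = 0) \<and> (\<forall>y\<in>bd h B. u y = Ph h B f y))
       \<and> (\<exists>v :: real^8 \<Rightarrow> real^8.
            (\<forall>y\<in>lattice h - B. Dh h v y = 0) \<and> (\<forall>y\<in>bd h B. v y = Qh h B f y)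
            \<and> (\<forall>e>0. \<exists>R. \<forall>y\<in>(lattice h - B) \<union> bd h B. norm y > R \<longrightarrow> norm (v y) < e))"
proof -
  \<comment> \<open>The Cauchy integral only sees \<open>f\<close> on the boundary, so extending by
    zero leaves it unchanged while meeting the support condition of
    \<open>Dh_cauchy\<close>.\<close>
  define g where "g x = (if x \<in> bd h B then f x else 0)" for x
  have fin: "finite B"
    by (rule finite_lattice_bounded [OF assms])
  have fin_bd: "finite (bd h B)"
    by (rule cauchy_const(2) [OF assms(1,2) fin lattice_zero])
  have cauchy_g: "cauchy h B f = cauchy h B g"
    by (rule ext) (simp add: cauchy_eq g_def)
  have D: "Dh h (cauchy h B g) y = Dh h (\<lambda>x. chi B x *\<^sub>R g x) y - chi B y *\<^sub>R Dh h g y" if "y \<in> lattice h" for y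
    by (rule Dh_cauchy [OF assms(1) that fin_bd]) (simp add: g_def)
  have S: "Sh h B f y = 2 *\<^sub>R (cauchy h B g y - chi B y *\<^sub>R f y) + f y" if "y \<in> bd h B" for y
    using cauchy_const(1) [OF assms(1,2) fin, of y "f y"] that bd_subset_lattice
    by (auto simp: Sh_def bd_int_Kstar_diff cauchy_g)
  \<comment> \<open>On \<open>B\<close>, where \<open>chi B\<close> is 1, \<open>D\<close> leaves
    \<open>Dh h (cauchy h B g) y\<close> equal to \<open>D (chi g) - D g\<close>, which the bracket
    cancels. Off \<open>B\<close>, where \<open>chi B\<close> is 0, the two terms of
    \<open>v\<close> have equal images under \<open>D\<close>.\<close>
  define u where "u y = cauchy h B g y + (g y - chi B y *\<^sub>R g y)" for y
  define v where "v y = chi B y *\<^sub>R g y - cauchy h B g y" for y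
  have "Dh h u y = 0" if "y \<in> B" for y
    using that D [of y] assms(2) by (auto simp: u_def [abs_def] Dh_add Dh_diff chi_def)
  moreover have "u y = Ph h B f y" if "y \<in> bd h B" for y
    unfolding u_def Ph_def S [OF that]
    by (rule cmp_eqI) (simp only: cmp_add cmp_diff cmp_scaleR g_def that if_True, simp add: algebra_simps)
  moreover have "Dh h v y = 0" if "y \<in> lattice h - B" for y
    using that D [of y] by (auto simp: v_def [abs_def] Dh_diff chi_def)
  moreover have "v y = Qh h B f y" if "y \<in> bd h B" for y
    unfolding v_def Qh_def S [OF that]
    by (rule cmp_eqI) (simp only: cmp_add cmp_diff cmp_scaleR g_def that if_True, simp add: algebra_simps)
  moreover have "\<exists>R. \<forall>y\<in>(lattice h - B) \<union> bd h B. norm y > R \<longrightarrow> norm (v y) < e" if "e > 0" for e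
  proof -
    obtain b where b: "\<And>x. x \<in> B \<Longrightarrow> norm x \<le> b"
      using assms(3) by (auto simp: bounded_iff)
    have "\<exists>a. \<forall>y. a \<le> norm y \<longrightarrow> norm (cauchy h B g y) < e"
      using cauchy_tendsto_zero [OF assms(1), of B g] that
      by (simp add: tendsto_iff eventually_at_infinity)
    then obtain a where a: "\<And>y. norm y \<ge> a \<Longrightarrow> norm (cauchy h B g y) < e"
      by blast
    \<comment> \<open>Beyond radius \<open>b\<close> the indicator of \<open>B\<close> vanishes, so
      \<open>v\<close> is minus the Cauchy integral there.\<close>
    have "norm (v y) < e" if "norm y > max a b" for y
      using that a [of y] b [of y] by (auto simp: v_def chi_def)
    then show ?thesis by blast
  qed
  ultimately show ?thesis
    by blast
qed

end
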